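(* Let $D\subset\mathbb{R}^n$, $n\geqslant 2$, be a domain, let $Q:\mathbb{R}^n\to[0,\infty]$ be a Lebesgue measurable function with $Q\in L^1_{\rm loc}(\mathbb{R}^n)$, and let $a\in\mathbb{R}^n$. Let $\mathfrak{F}_{Q,a}(D)$ be the family of all open discrete mappings $f:D\to\mathbb{R}^n\setminus\{a\}$ that satisfy the inverse Poletsky inequality with majorant $Q$ at every (finite) point $y_0\in\mathbb{R}^n$. Then the family $\mathfrak{F}_{Q,a}(D)$ is equicontinuous at each point $x_0\in D$ (as a family of mappings into $(\overline{\mathbb{R}^n},h)$).
   Context: A domain is a nonempty connected open set. $S(y_0,r)=\{y\in\mathbb{R}^n:|y-y_0|=r\}$, $A(y_0,r_1,r_2)=\{y\in\mathbb{R}^n:r_1<|y-y_0|<r_2\}$, $m$ is Lebesgue measure in $\mathbb{R}^n$, and $\overline{\mathbb{R}^n}=\mathbb{R}^n\cup\{\infty\}$. A mapping $f:D\to\mathbb{R}^n$ is discrete if $f^{-1}(y)$ consists of isolated points for each $y\in\mathbb{R}^n$; it is open if the image of every open subset of $D$ is open in $\mathbb{R}^n$. Mappings are continuous. Modulus. A Borel function $\rho:\mathbb{R}^n\to[0,\infty]$ is admissible for a family $\Gamma$ of paths in $\mathbb{R}^n$ ($\rho\in\mathrm{adm}\,\Gamma$) if $\int_\gamma\rho(x)\,|dx|\geqslant1$ for all locally rectifiable $\gamma\in\Gamma$. The ($n$-)modulus of $\Gamma$ is $M(\Gamma)=\inf_{\rho\in\mathrm{adm}\,\Gamma}\int_{\mathbb{R}^n}\rho^n(x)\,dm(x)$.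 Path families. For $E,F\subset\overline{\mathbb{R}^n}$ and a domain $G\subset\mathbb{R}^n$, $\Gamma(E,F,G)$ is the family of all paths $\gamma:[a,b]\to\overline{\mathbb{R}^n}$ with $\gamma(a)\in E$, $\gamma(b)\in F$ and $\gamma(t)\in G$ for $t\in(a,b)$. The family $\Gamma_f(y_0,r_1,r_2)$ consists of all paths $\gamma$ in $D$ such that $f(\gamma)\in\Gamma(S(y_0,r_1),S(y_0,r_2),A(y_0,r_1,r_2))$. Inverse Poletsky inequality. $f$ satisfies the inverse Poletsky inequality with majorant $Q$ at $y_0$ if there is $r_0=r_0(y_0)>0$, $r_0<d_0=\sup_{y\in f(D)}|y-y_0|$, such that $$M(\Gamma_f(y_0,r_1,r_2))\leqslant\int_{f(D)\cap A(y_0,r_1,r_2)}Q(y)\,\eta^n(|y-y_0|)\,dm(y)$$ for any $0<r_1<r_2<r_0$ and any Lebesgue measurable function $\eta:(r_1,r_2)\to[0,\infty]$ with $\int_{r_1}^{r_2}\eta(r)\,dr\geqslant1$. Chordal metric: $h(x,\infty)=\frac{1}{\sqrt{1+|x|^2}}$ and $h(x,y)=\frac{|x-y|}{\sqrt{1+|x|^2}\sqrt{1+|y|^2}}$ for $x\ne\infty\ne y$. A family $\mathfrak{F}$ of mappings $f:D\to\overline{\mathbb{R}^n}$ is equicontinuous at $x_0\in D$ if for every $\varepsilon>0$ there is $\delta>0$ such that $h(f(x),f(x_0))<\varepsilon$ for all $f\in\mathfrak{F}$ and all $x\in D$ with $|x-x_0|<\delta$. *)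

theory Defs
  imports "HOL-Analysis.Analysis"
begin

text \<open>
  \<open>\<real>\<^sup>n\<close> is a Euclidean space \<open>'a\<close> with \<open>n = DIM('a)\<close>, and \<open>\<real>\<^sup>n \<union> {\<infinity>}\<close> is \<open>'a option\<close> with
  \<open>None\<close> as the point at infinity.
\<close>

text \<open>
  A triple \<open>(a, b, \<gamma>)\<close> stands for the path \<open>\<gamma>\<close> restricted to \<open>[a, b]\<close>; the values of \<open>\<gamma>\<close> outside
  \<open>[a, b]\<close> are irrelevant.
\<close>

type_synonym 'a curve = "real \<times> real \<times> (real \<Rightarrow> 'a)"

definition curve_length :: "(real \<Rightarrow> 'a::metric_space) \<Rightarrow> real \<Rightarrow> real \<Rightarrow> ennreal" where
  "curve_length \<gamma> a b =
     (SUP (N, t) \<in> {(N::nat, t::nat \<Rightarrow> real). mono_on {..N} t \<and> t 0 = a \<and> t N = b}.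
        \<Sum>i<N. ennreal (dist (\<gamma> (t i)) (\<gamma> (t (Suc i)))))"

text \<open>
  A path on a compact interval is locally rectifiable iff it is rectifiable.
\<close>

fun rectifiable :: "'a::metric_space curve \<Rightarrow> bool" where
  "rectifiable (a, b, \<gamma>) \<longleftrightarrow> curve_length \<gamma> a b < \<infinity>"

text \<open>
  The representation of \<open>\<gamma>\<close> by arc length, i.e. the \<open>\<gamma>\<^sup>0\<close> with \<open>\<gamma>\<^sup>0 (s\<^sub>\<gamma> t) = \<gamma> t\<close> where \<open>s\<^sub>\<gamma> t\<close> is the
  length of \<open>\<gamma>\<close> on \<open>[a, t]\<close>. The choice of preimage made by \<^const>\<open>inv_into\<close> is immaterial for
  rectifiable \<open>\<gamma>\<close>, since then \<open>\<gamma>\<close> is constant on the level sets of \<open>s\<^sub>\<gamma>\<close>.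
\<close>

definition arc_length_repr :: "(real \<Rightarrow> 'a::metric_space) \<Rightarrow> real \<Rightarrow> real \<Rightarrow> real \<Rightarrow> 'a" where
  "arc_length_repr \<gamma> a b s = \<gamma> (inv_into {a..b} (curve_length \<gamma> a) (ennreal s))"

text \<open>\<open>\<integral>\<^sub>\<gamma> \<rho> |dx|\<close>, meaningful for rectifiable paths.\<close>

fun curve_integral :: "('a::metric_space \<Rightarrow> ennreal) \<Rightarrow> 'a curve \<Rightarrow> ennreal" where
  "curve_integral \<rho> (a, b, \<gamma>) =
     (\<integral>\<^sup>+ s \<in> {0..enn2real (curve_length \<gamma> a b)}. \<rho> (arc_length_repr \<gamma> a b s) \<partial>lborel)"

definition admissible :: "'a::euclidean_space curve set \<Rightarrow> ('a \<Rightarrow> ennreal) set" where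
  "admissible \<Gamma> = {\<rho> \<in> borel_measurable borel.
     \<forall>c\<in>\<Gamma>. rectifiable c \<longrightarrow> 1 \<le> curve_integral \<rho> c}"

definition modulus :: "'a::euclidean_space curve set \<Rightarrow> ennreal" where
  "modulus \<Gamma> = (INF \<rho>\<in>admissible \<Gamma>. \<integral>\<^sup>+ x. \<rho> x ^ DIM('a) \<partial>lborel)"

definition annulus :: "'a::metric_space \<Rightarrow> real \<Rightarrow> real \<Rightarrow> 'a set" where
  "annulus y0 r1 r2 = {y. r1 < dist y y0 \<and> dist y y0 < r2}"

definition paths_joining ::
    "'a::euclidean_space option set \<Rightarrow> 'a option set \<Rightarrow> 'a set \<Rightarrow> 'a option curve set" where
  "paths_joining E F G = {(a, b, \<gamma>). a \<le> b \<and>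
     continuous_map (top_of_set {a..b}) (Alexandroff_compactification euclidean) \<gamma> \<and>
     \<gamma> a \<in> E \<and> \<gamma> b \<in> F \<and> (\<forall>t\<in>{a<..<b}. \<gamma> t \<in> Some ` G)}"

definition lifted_paths ::
    "'a::euclidean_space set \<Rightarrow> ('a \<Rightarrow> 'a) \<Rightarrow> 'a \<Rightarrow> real \<Rightarrow> real \<Rightarrow> 'a curve set" where
  "lifted_paths D f y0 r1 r2 = {(a, b, \<gamma>). a \<le> b \<and> continuous_on {a..b} \<gamma> \<and> \<gamma> ` {a..b} \<subseteq> D \<and>
     (a, b, \<lambda>t. Some (f (\<gamma> t))) \<in>
       paths_joining (Some ` sphere y0 r1) (Some ` sphere y0 r2) (annulus y0 r1 r2)}"

definition inverse_Poletsky ::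
    "'a::euclidean_space set \<Rightarrow> ('a \<Rightarrow> ennreal) \<Rightarrow> ('a \<Rightarrow> 'a) \<Rightarrow> 'a \<Rightarrow> bool" where
  "inverse_Poletsky D Q f y0 \<longleftrightarrow>
     (\<exists>r0>0. ennreal r0 < (SUP y\<in>f ` D. ennreal (dist y y0)) \<and>
        (\<forall>r1 r2. \<forall>\<eta> :: real \<Rightarrow> ennreal.
           0 < r1 \<and> r1 < r2 \<and> r2 < r0 \<and>
           \<eta> \<in> borel_measurable (lebesgue_on {r1<..<r2}) \<and>
           1 \<le> (\<integral>\<^sup>+ r. \<eta> r \<partial>lebesgue_on {r1<..<r2}) \<longrightarrow>
           modulus (lifted_paths D f y0 r1 r2)
             \<le> (\<integral>\<^sup>+ y \<in> f ` D \<inter> annulus y0 r1 r2. Q y * \<eta> (dist y y0) ^ DIM('a) \<partial>lebesgue)))"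

definition locally_integrable :: "('a::euclidean_space \<Rightarrow> ennreal) \<Rightarrow> bool" where
  "locally_integrable Q \<longleftrightarrow> Q \<in> borel_measurable lebesgue \<and>
     (\<forall>K. compact K \<longrightarrow> (\<integral>\<^sup>+ x \<in> K. Q x \<partial>lebesgue) < \<infinity>)"

text \<open>
  Mappings \<open>D \<rightarrow> \<real>\<^sup>n\<close> are total functions whose values outside \<open>D\<close> are irrelevant.
\<close>

definition discrete_map_on :: "'a::topological_space set \<Rightarrow> ('a \<Rightarrow> 'b) \<Rightarrow> bool" where
  "discrete_map_on D f \<longleftrightarrow> (\<forall>y. discrete {x \<in> D. f x = y})"

definition poletsky_family ::
    "('a::euclidean_space \<Rightarrow> ennreal) \<Rightarrow> 'a \<Rightarrow> 'a set \<Rightarrow> ('a \<Rightarrow> 'a) set" where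
  "poletsky_family Q a D = {f. continuous_on D f \<and> f ` D \<subseteq> - {a} \<and>
     open_map (top_of_set D) euclidean f \<and> discrete_map_on D f \<and>
     (\<forall>y0. inverse_Poletsky D Q f y0)}"

fun chordal_dist :: "'a::real_normed_vector option \<Rightarrow> 'a option \<Rightarrow> real" where
  "chordal_dist (Some x) (Some y) =
     norm (x - y) / (sqrt (1 + (norm x)\<^sup>2) * sqrt (1 + (norm y)\<^sup>2))"
| "chordal_dist (Some x) None = 1 / sqrt (1 + (norm x)\<^sup>2)"
| "chordal_dist None (Some y) = 1 / sqrt (1 + (norm y)\<^sup>2)"
| "chordal_dist None None = 0"

definition chordal_equicontinuous_at ::
    "'a::metric_space set \<Rightarrow> ('a \<Rightarrow> 'b::real_normed_vector option) set \<Rightarrow> 'a \<Rightarrow> bool" where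
  "chordal_equicontinuous_at D \<F> x0 \<longleftrightarrow>
     (\<forall>\<epsilon>>0. \<exists>\<delta>>0. \<forall>f\<in>\<F>. \<forall>x\<in>D. dist x x0 < \<delta> \<longrightarrow> chordal_dist (f x) (f x0) < \<epsilon>)"

end

theory Submission
  imports Defs
begin

text \<open>
  Let \<open>f\<close> be in the family, with \<open>f x\<^sub>1\<close>, \<open>f x\<^sub>2\<close> at distance at least \<open>\<epsilon>\<close> and \<open>x\<^sub>1\<close>, \<open>x\<^sub>2\<close> close to \<open>x\<^sub>0\<close>. If
  \<open>f x\<^sub>1\<close> is the one closer to \<open>a\<close>, the segment from \<open>f x\<^sub>1\<close> to \<open>a\<close> and the ray from \<open>f x\<^sub>2\<close> pointing away
  from \<open>a\<close> are at distance at least \<open>\<epsilon> / 2\<close>. Since \<open>f\<close> is open and omits \<open>a\<close> and \<open>\<infinity>\<close>, the components of their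
  preimages through \<open>x\<^sub>1\<close> and \<open>x\<^sub>2\<close> reach a fixed sphere around \<open>x\<^sub>0\<close>, so they both cross many disjoint
  annuli around \<open>x\<^sub>0\<close> when \<open>x\<^sub>1\<close> and \<open>x\<^sub>2\<close> are close to \<open>x\<^sub>0\<close>. Averaging over segments from a point of one
  component via a random point to the other shows that each annulus contributes a fixed amount to the energy
  of a density whose integral over all such broken lines is bounded below. On the other hand there is
  such a density whose energy is bounded independently of \<open>f\<close>, a contradiction.

  The radius \<open>r\<^sub>0 y\<close> up to which the inverse Poletsky inequality holds may depend on \<open>f\<close> and on \<open>y\<close>,
  so the density is glued from rings of tiny radius. The sets \<open>A\<^sub>k = {y. r\<^sub>0 y > 1 / (k + 1)}\<close> exhaust
  the space, so \<open>k\<^sub>j\<close> can be chosen such that the complement of the closure of \<open>A\<close> for \<open>k\<^sub>j\<close> has tiny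
  mass with respect to \<open>Q + 1\<close>. At level \<open>j\<close> one covers what the earlier levels missed by balls
  centred in that set whose rings avoid the closures of the earlier ones; the level energies then
  decay geometrically.
\<close>

section \<open>Integrals over segments and crossings of rings\<close>

text \<open>The line integral of \<open>\<rho>\<close> along a segment, written in the affine
  parameter so that homotheties and Fubini apply to it directly; \<open>curve_integral_line\<close>
  links it to the arc length integral. For \<open>p = q\<close> it is 0.\<close>

definition segment_integral :: "('a::euclidean_space \<Rightarrow> ennreal) \<Rightarrow> 'a \<Rightarrow> 'a \<Rightarrow> ennreal" where
  "segment_integral \<rho> p q =
     ennreal (norm (q - p)) * (\<integral>\<^sup>+ t \<in> {0..1}. \<rho> (p + t *\<^sub>R (q - p)) \<partial>lborel)"

lemma measurable_affine_param [measurable]: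
  fixes p v :: "'a::euclidean_space"
  assumes [measurable]: "\<rho> \<in> borel_measurable borel"
  shows "(\<lambda>t::real. \<rho> (p + t *\<^sub>R v)) \<in> borel_measurable borel"
  by measurable

lemma segment_integral_commute:
  fixes \<rho> :: "'a::euclidean_space \<Rightarrow> ennreal"
  assumes [measurable]: "\<rho> \<in> borel_measurable borel"
  shows "segment_integral \<rho> p q = segment_integral \<rho> q p"
proof -
  have "(\<integral>\<^sup>+ t \<in> {0..1}. \<rho> (p + t *\<^sub>R (q - p)) \<partial>lborel) =
        (\<integral>\<^sup>+ t. \<rho> (p + (1 - t) *\<^sub>R (q - p)) * indicator {0..1} (1 - t) \<partial>lborel)"
    by (subst nn_integral_real_affine[where c = "-1" and t = 1]) auto
  also have "\<dots> = (\<integral>\<^sup>+ t \<in> {0..1}. \<rho> (q + t *\<^sub>R (p - q)) \<partial>lborel)"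
    by (intro nn_integral_cong) (auto simp: algebra_simps indicator_def)
  finally show ?thesis
    by (simp add: segment_integral_def norm_minus_commute)
qed

section \<open>Straight paths: length and line integral\<close>

lemma curve_length_line:
  fixes p v :: "'a::real_normed_vector"
  assumes "a \<le> b"
  shows "curve_length (\<lambda>t. p + t *\<^sub>R v) a b = ennreal ((b - a) * norm v)"
proof (rule antisym)
  show "curve_length (\<lambda>t. p + t *\<^sub>R v) a b \<le> ennreal ((b - a) * norm v)"
    unfolding curve_length_def
  proof (rule SUP_least, clarify)
    fix N :: nat and t :: "nat \<Rightarrow> real"
    assume mono: "mono_on {..N} t" and ab: "a = t 0" "b = t N"
    have step: "t i \<le> t (Suc i)" if "i < N" for i
      using mono that by (auto intro: mono_onD)
    have "(\<Sum>i<N. ennreal (dist (p + t i *\<^sub>R v) (p + t (Suc i) *\<^sub>R v))) =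
          (\<Sum>i<N. ennreal ((t (Suc i) - t i) * norm v))"
    proof (intro sum.cong refl)
      fix i assume "i \<in> {..<N}"
      then have "dist (p + t i *\<^sub>R v) (p + t (Suc i) *\<^sub>R v) = (t (Suc i) - t i) * norm v"
        using step[of i] by (auto simp: dist_commute[of "p + t i *\<^sub>R v"] dist_norm simp flip: scaleR_left_diff_distrib)
      then show "ennreal (dist (p + t i *\<^sub>R v) (p + t (Suc i) *\<^sub>R v)) = ennreal ((t (Suc i) - t i) * norm v)"
        by (simp only:)
    qed
    also have "\<dots> = ennreal (\<Sum>i<N. (t (Suc i) - t i) * norm v)"
      using step by (intro sum_ennreal) auto
    also have "(\<Sum>i<N. (t (Suc i) - t i) * norm v) = (t N - t 0) * norm v"
      by (simp add: sum_distrib_right[symmetric] sum_lessThan_telescope)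
    finally show "(\<Sum>i<N. ennreal (dist (p + t i *\<^sub>R v) (p + t (Suc i) *\<^sub>R v))) \<le> ennreal ((t N - t 0) * norm v)"
      by simp
  qed
  have "ennreal ((b - a) * norm v) = (\<Sum>i<(1::nat). ennreal (dist (p + (if i = 0 then a else b) *\<^sub>R v) (p + (if Suc i = 0 then a else b) *\<^sub>R v)))"
    using assms by (simp add: dist_norm flip: scaleR_left_diff_distrib)
  also have "\<dots> \<le> curve_length (\<lambda>t. p + t *\<^sub>R v) a b"
    unfolding curve_length_def using assms
    by (intro SUP_upper2[of "(1, \<lambda>i. if i = 0 then a else b)"]) (auto simp: mono_on_def)
  finally show "ennreal ((b - a) * norm v) \<le> curve_length (\<lambda>t. p + t *\<^sub>R v) a b" .
qed

text \<open>Along a nondegenerate line arc length is an injective affine function of the parameter,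
  so the choice made by \<open>inv_into\<close> is forced and the identity is an affine
  substitution.\<close>

lemma curve_integral_line:
  fixes p v :: "'a::euclidean_space"
  assumes [measurable]: "\<rho> \<in> borel_measurable borel" and "a \<le> b" "v \<noteq> 0"
  shows "curve_integral \<rho> (a, b, \<lambda>t. p + t *\<^sub>R v) =
           ennreal (norm v) * (\<integral>\<^sup>+ t \<in> {a..b}. \<rho> (p + t *\<^sub>R v) \<partial>lborel)"
proof -
  have v: "norm v > 0" using assms by simp
  have inv: "inv_into {a..b} (curve_length (\<lambda>t. p + t *\<^sub>R v) a) (ennreal s) = a + s / norm v"
    if "0 \<le> s" "s \<le> (b - a) * norm v" for s
  proof (rule inv_into_f_eq)
    show "inj_on (curve_length (\<lambda>t. p + t *\<^sub>R v) a) {a..b}"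
      using v by (auto simp: inj_on_def curve_length_line)
    show "a + s / norm v \<in> {a..b}" "curve_length (\<lambda>t. p + t *\<^sub>R v) a (a + s / norm v) = ennreal s"
      using that v by (auto simp: curve_length_line field_simps)
  qed
  have "curve_integral \<rho> (a, b, \<lambda>t. p + t *\<^sub>R v) =
        (\<integral>\<^sup>+ s. \<rho> (p + (a + s / norm v) *\<^sub>R v) * indicator {0..(b - a) * norm v} s \<partial>lborel)"
    using assms by (auto simp: curve_length_line arc_length_repr_def inv indicator_def intro!: nn_integral_cong)
  also have "\<dots> = ennreal (norm v) * (\<integral>\<^sup>+ t. \<rho> (p + (a + (- a * norm v + norm v * t) / norm v) *\<^sub>R v) *
      indicator {0..(b - a) * norm v} (- a * norm v + norm v * t) \<partial>lborel)"
    using v by (subst nn_integral_real_affine[where c = "norm v" and t = "- a * norm v"]) auto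
  also have "(\<lambda>t. \<rho> (p + (a + (- a * norm v + norm v * t) / norm v) *\<^sub>R v) *
      indicator {0..(b - a) * norm v} (- a * norm v + norm v * t)) =
      (\<lambda>t. \<rho> (p + t *\<^sub>R v) * indicator {a..b} t)"
  proof (rule ext, rule arg_cong2[where f = "(*)"])
    fix t
    have "- a * norm v + norm v * t = (t - a) * norm v" by (simp add: algebra_simps)
    moreover have "a + (t - a) * norm v / norm v = t" using v by simp
    ultimately show "\<rho> (p + (a + (- a * norm v + norm v * t) / norm v) *\<^sub>R v) = \<rho> (p + t *\<^sub>R v)"
      by simp
    show "indicator {0..(b - a) * norm v} (- a * norm v + norm v * t) = (indicator {a..b} t :: ennreal)"
      unfolding \<open>- a * norm v + norm v * t = (t - a) * norm v\<close> indicator_def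
      using v by (simp add: zero_le_mult_iff)
  qed
  finally show ?thesis .
qed

text \<open>Let \<open>\<beta>\<close> be the first time with \<open>r2 \<le> g \<beta>\<close>, and
  \<open>\<alpha>\<close> the last time before it with \<open>g \<alpha> \<le> r1\<close>. The
  strict bounds in between push the points given by the intermediate value theorem to the two ends.
  This cuts out of a path a piece that runs through the ring exactly as \<open>lifted_paths\<close>
  demands.\<close>

lemma last_crossing:
  fixes g :: "real \<Rightarrow> real"
  assumes g: "continuous_on {s..t} g" and "s \<le> t" "g s \<le> r1" "r2 \<le> g t" "r1 < r2"
  obtains \<alpha> \<beta> where "s \<le> \<alpha>" "\<alpha> < \<beta>" "\<beta> \<le> t" "g \<alpha> = r1" "g \<beta> = r2"
    "\<And>\<tau>. \<alpha> < \<tau> \<Longrightarrow> \<tau> < \<beta> \<Longrightarrow> r1 < g \<tau> \<and> g \<tau> < r2"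
proof -
  have "closed {\<tau> \<in> {s..t}. r2 \<le> g \<tau>}"
    by (intro continuous_closed_preimage_constant continuous_on_closed_Collect_le g) auto
  then have "compact {\<tau> \<in> {s..t}. r2 \<le> g \<tau>}"
    by (rule compact_eq_bounded_closed[THEN iffD2, OF conjI, rotated])
       (auto intro: bounded_subset[of "{s..t}"])
  moreover have "{\<tau> \<in> {s..t}. r2 \<le> g \<tau>} \<noteq> {}" using assms by auto
  ultimately obtain \<beta> where \<beta>: "\<beta> \<in> {s..t}" "r2 \<le> g \<beta>" and \<beta>min: "\<And>\<tau>. \<tau> \<in> {s..t} \<Longrightarrow> r2 \<le> g \<tau> \<Longrightarrow> \<beta> \<le> \<tau>"
    using compact_attains_inf[of "{\<tau> \<in> {s..t}. r2 \<le> g \<tau>}"] by auto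
  have g': "continuous_on {s..\<beta>} g" using g \<beta> by (auto intro: continuous_on_subset)
  have "closed {\<tau> \<in> {s..\<beta>}. g \<tau> \<le> r1}"
    by (intro continuous_on_closed_Collect_le g') auto
  then have "compact {\<tau> \<in> {s..\<beta>}. g \<tau> \<le> r1}"
    by (rule compact_eq_bounded_closed[THEN iffD2, OF conjI, rotated])
       (auto intro: bounded_subset[of "{s..\<beta>}"])
  moreover have "{\<tau> \<in> {s..\<beta>}. g \<tau> \<le> r1} \<noteq> {}" using assms \<beta> by auto
  ultimately obtain \<alpha> where \<alpha>: "\<alpha> \<in> {s..\<beta>}" "g \<alpha> \<le> r1" and \<alpha>max: "\<And>\<tau>. \<tau> \<in> {s..\<beta>} \<Longrightarrow> g \<tau> \<le> r1 \<Longrightarrow> \<tau> \<le> \<alpha>"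
    using compact_attains_sup[of "{\<tau> \<in> {s..\<beta>}. g \<tau> \<le> r1}"] by auto
  have ab: "\<alpha> < \<beta>" using \<alpha> \<beta> \<open>r1 < r2\<close> by (cases "\<alpha> = \<beta>") auto
  have btw: "r1 < g \<tau> \<and> g \<tau> < r2" if "\<alpha> < \<tau>" "\<tau> < \<beta>" for \<tau>
    using \<alpha>max[of \<tau>] \<beta>min[of \<tau>] that \<alpha> \<beta> by force
  have g'': "continuous_on {\<alpha>..\<beta>} g" using g \<alpha> \<beta> by (auto intro: continuous_on_subset)
  obtain x where x: "\<alpha> \<le> x" "x \<le> \<beta>" "g x = r1"
    using IVT'[of g \<alpha> r1 \<beta>] g'' \<alpha> \<beta> ab \<open>r1 < r2\<close> by auto
  obtain y where y: "\<alpha> \<le> y" "y \<le> \<beta>" "g y = r2"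
    using IVT'[of g \<alpha> r2 \<beta>] g'' \<alpha> \<beta> ab \<open>r1 < r2\<close> by auto
  have "x = \<alpha>"
  proof (rule ccontr)
    assume "x \<noteq> \<alpha>"
    with x \<beta> \<open>r1 < r2\<close> have "\<alpha> < x" "x < \<beta>" by (cases "x = \<beta>"; simp)+
    then show False using btw[of x] x by simp
  qed
  moreover have "y = \<beta>"
  proof (rule ccontr)
    assume "y \<noteq> \<beta>"
    with y \<alpha> \<open>r1 < r2\<close> have "\<alpha> < y" "y < \<beta>" by (cases "y = \<alpha>"; simp)+
    then show False using btw[of y] y by simp
  qed
  ultimately show thesis using that[of \<alpha> \<beta>] \<alpha> \<beta> ab btw x y by auto
qed

lemma lifted_paths_line:
  fixes f :: "'a::euclidean_space \<Rightarrow> 'a"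
  assumes f: "continuous_on D f" and "\<alpha> \<le> \<beta>" and sub: "\<And>t. t \<in> {\<alpha>..\<beta>} \<Longrightarrow> p + t *\<^sub>R v \<in> D"
    and ends: "dist (f (p + \<alpha> *\<^sub>R v)) y0 = r1" "dist (f (p + \<beta> *\<^sub>R v)) y0 = r2"
    and btw: "\<And>t. \<alpha> < t \<Longrightarrow> t < \<beta> \<Longrightarrow> r1 < dist (f (p + t *\<^sub>R v)) y0 \<and> dist (f (p + t *\<^sub>R v)) y0 < r2"
  shows "(\<alpha>, \<beta>, \<lambda>t. p + t *\<^sub>R v) \<in> lifted_paths D f y0 r1 r2"
proof -
  have c: "continuous_on {\<alpha>..\<beta>} (\<lambda>t. p + t *\<^sub>R v)" by (intro continuous_intros)
  have "continuous_on {\<alpha>..\<beta>} (\<lambda>t. f (p + t *\<^sub>R v))"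
    by (rule continuous_on_compose2[OF f c]) (use sub in auto)
  then have "continuous_map (top_of_set {\<alpha>..\<beta>}) euclidean (\<lambda>t. f (p + t *\<^sub>R v))"
    by simp
  from continuous_map_compose[OF this continuous_map_Some]
  have "continuous_map (top_of_set {\<alpha>..\<beta>}) (Alexandroff_compactification euclidean) (\<lambda>t. Some (f (p + t *\<^sub>R v)))"
    by (simp add: o_def)
  then show ?thesis
    using assms c by (auto simp: lifted_paths_def paths_joining_def annulus_def dist_commute)
qed

text \<open>A modulus strictly below \<open>B\<close> leaves room for an admissible density of
  energy below \<open>B\<close>. Cutting it off outside the preimage of \<open>cball y0 r2\<close>
  does no harm, because the crossing pieces of segments stay in that preimage. The localised support
  is what later bounds the overlap of the densities of many rings.\<close>

lemma ring_density:
  fixes f :: "'a::euclidean_space \<Rightarrow> 'a"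
  assumes D: "open D" and f: "continuous_on D f" and r: "r1 < r2"
    and M: "modulus (lifted_paths D f y0 r1 r2) < B"
  obtains \<rho> where "\<rho> \<in> borel_measurable borel" "(\<integral>\<^sup>+ x. \<rho> x ^ DIM('a) \<partial>lborel) \<le> B"
    "\<And>x. \<rho> x \<noteq> 0 \<Longrightarrow> dist (f x) y0 \<le> r2"
    "\<And>p q x y. closed_segment p q \<subseteq> D \<Longrightarrow> x \<in> closed_segment p q \<Longrightarrow> y \<in> closed_segment p q \<Longrightarrow>
       dist (f x) y0 \<le> r1 \<Longrightarrow> r2 \<le> dist (f y) y0 \<Longrightarrow> 1 \<le> segment_integral \<rho> p q"
proof -
  define S where "S = D \<inter> f -` cball y0 r2"
  have "closedin (top_of_set D) S"
    unfolding S_def by (intro continuous_closedin_preimage f) auto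
  then obtain T where "closed T" "S = D \<inter> T" by (auto simp: closedin_closed)
  then have S [measurable]: "S \<in> sets borel" using D by auto
  from M obtain \<rho>0 where \<rho>0: "\<rho>0 \<in> admissible (lifted_paths D f y0 r1 r2)"
      and B: "(\<integral>\<^sup>+ x. \<rho>0 x ^ DIM('a) \<partial>lborel) < B"
    by (auto simp: modulus_def INF_less_iff)
  then have [measurable]: "\<rho>0 \<in> borel_measurable borel" by (simp add: admissible_def)
  define \<rho> where "\<rho> x = \<rho>0 x * indicator S x" for x
  have [measurable]: "\<rho> \<in> borel_measurable borel"
    unfolding \<rho>_def by measurable
  \<comment> \<open>The case where the point mapped into the inner ball precedes the point mapped
    outside the outer one; the opposite order is reduced to it by reversing the segment.\<close>
  have oriented: "1 \<le> segment_integral \<rho> p q"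
    if pq: "closed_segment p q \<subseteq> D" and st: "0 \<le> s" "s \<le> t" "t \<le> 1"
      and gs: "dist (f (p + s *\<^sub>R (q - p))) y0 \<le> r1" and gt: "r2 \<le> dist (f (p + t *\<^sub>R (q - p))) y0"
    for p q s t
  proof -
    have inD: "p + \<tau> *\<^sub>R (q - p) \<in> D" if "0 \<le> \<tau>" "\<tau> \<le> 1" for \<tau>
      using that pq by (force simp: closed_segment_def algebra_simps)
    have c: "continuous_on {s..t} (\<lambda>\<tau>. dist (f (p + \<tau> *\<^sub>R (q - p))) y0)"
      using st by (intro continuous_intros continuous_on_compose2[OF f]) (auto intro!: inD)
    obtain \<alpha> \<beta> where ab: "s \<le> \<alpha>" "\<alpha> < \<beta>" "\<beta> \<le> t"
      "dist (f (p + \<alpha> *\<^sub>R (q - p))) y0 = r1" "dist (f (p + \<beta> *\<^sub>R (q - p))) y0 = r2"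
      "\<And>\<tau>. \<alpha> < \<tau> \<Longrightarrow> \<tau> < \<beta> \<Longrightarrow> r1 < dist (f (p + \<tau> *\<^sub>R (q - p))) y0 \<and> dist (f (p + \<tau> *\<^sub>R (q - p))) y0 < r2"
      using last_crossing[OF c st(2) gs gt r] by blast
    have le: "dist (f (p + \<tau> *\<^sub>R (q - p))) y0 \<le> r2" if "\<alpha> \<le> \<tau>" "\<tau> \<le> \<beta>" for \<tau>
      using ab(4,5) ab(6)[of \<tau>] r that by (cases "\<tau> = \<alpha>"; cases "\<tau> = \<beta>") auto
    have "q - p \<noteq> 0"
    proof
      assume "q - p = 0"
      then show False using ab(4,5) r by simp
    qed
    have "(\<alpha>, \<beta>, \<lambda>\<tau>. p + \<tau> *\<^sub>R (q - p)) \<in> lifted_paths D f y0 r1 r2"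
      using ab st by (intro lifted_paths_line f) (auto intro!: inD)
    moreover have "rectifiable (\<alpha>, \<beta>, \<lambda>\<tau>. p + \<tau> *\<^sub>R (q - p))"
      using ab by (simp add: curve_length_line)
    ultimately have "1 \<le> curve_integral \<rho>0 (\<alpha>, \<beta>, \<lambda>\<tau>. p + \<tau> *\<^sub>R (q - p))"
      using \<rho>0 unfolding admissible_def by blast
    also have "\<dots> = ennreal (norm (q - p)) * (\<integral>\<^sup>+ \<tau> \<in> {\<alpha>..\<beta>}. \<rho>0 (p + \<tau> *\<^sub>R (q - p)) \<partial>lborel)"
      using ab \<open>q - p \<noteq> 0\<close> by (intro curve_integral_line) auto
    also have "\<dots> \<le> segment_integral \<rho> p q"
      unfolding segment_integral_def
    proof (intro mult_left_mono nn_integral_mono)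
      fix \<tau> :: real
      have "p + \<tau> *\<^sub>R (q - p) \<in> S" if "\<alpha> \<le> \<tau>" "\<tau> \<le> \<beta>"
        using that ab st le[of \<tau>] inD[of \<tau>] by (simp add: S_def dist_commute)
      then show "\<rho>0 (p + \<tau> *\<^sub>R (q - p)) * indicator {\<alpha>..\<beta>} \<tau> \<le> \<rho> (p + \<tau> *\<^sub>R (q - p)) * indicator {0..1} \<tau>"
        using ab st by (auto simp: \<rho>_def indicator_def)
    qed simp
    finally show ?thesis .
  qed
  show thesis
  proof (rule that[of \<rho>])
    have "(\<integral>\<^sup>+ x. \<rho> x ^ DIM('a) \<partial>lborel) \<le> (\<integral>\<^sup>+ x. \<rho>0 x ^ DIM('a) \<partial>lborel)"
      by (intro nn_integral_mono power_mono_ennreal) (auto simp: \<rho>_def indicator_def)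
    with B show "(\<integral>\<^sup>+ x. \<rho> x ^ DIM('a) \<partial>lborel) \<le> B" by simp
    show "dist (f x) y0 \<le> r2" if "\<rho> x \<noteq> 0" for x
      using that by (auto simp: \<rho>_def S_def indicator_def dist_commute split: if_splits)
    show "1 \<le> segment_integral \<rho> p q"
      if pq: "closed_segment p q \<subseteq> D" 
        and xy: "x \<in> closed_segment p q" "y \<in> closed_segment p q"
        and fx: "dist (f x) y0 \<le> r1" and fy: "r2 \<le> dist (f y) y0" for p q x y
    proof -
      obtain s t where s: "0 \<le> s" "s \<le> 1" "x = p + s *\<^sub>R (q - p)" and t: "0 \<le> t" "t \<le> 1" "y = p + t *\<^sub>R (q - p)"
        using xy by (auto simp: closed_segment_def algebra_simps)
      show ?thesis
      proof (cases "s \<le> t")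
        case True
        then show ?thesis using oriented[of p q s t] pq s t fx fy by simp
      next
        case False
        have "x = q + (1 - s) *\<^sub>R (p - q)" "y = q + (1 - t) *\<^sub>R (p - q)"
          using s t by (auto simp: algebra_simps)
        then have "1 \<le> segment_integral \<rho> q p"
          using oriented[of q p "1 - s" "1 - t"] pq s t fx fy False by (simp add: closed_segment_commute)
        then show ?thesis by (simp add: segment_integral_commute[of \<rho> p q])
      qed
    qed
  qed simp
qed

text \<open>The constant \<open>\<eta> = 1 / (r2 - r1)\<close> has integral exactly 1. Enlarging the
  domain of integration from the part of the image in the annulus to a closed ball makes the bound
  independent of \<open>f\<close>; only the range of admissible radii still depends on it.\<close>

lemma poletsky_ring_modulus:
  fixes f :: "'a::euclidean_space \<Rightarrow> 'a"
  assumes P: "inverse_Poletsky D Q f y0" and Q [measurable]: "Q \<in> borel_measurable lebesgue"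
  obtains r0 where "r0 > 0" "\<And>r1 r2. 0 < r1 \<Longrightarrow> r1 < r2 \<Longrightarrow> r2 < r0 \<Longrightarrow>
     modulus (lifted_paths D f y0 r1 r2) \<le> ennreal (1 / (r2 - r1)) ^ DIM('a) * (\<integral>\<^sup>+ y \<in> cball y0 r2. Q y \<partial>lebesgue)"
proof -
  from P obtain r0 where "r0 > 0" and r0: "\<And>r1 r2 \<eta>. 0 < r1 \<Longrightarrow> r1 < r2 \<Longrightarrow> r2 < r0 \<Longrightarrow>
           \<eta> \<in> borel_measurable (lebesgue_on {r1<..<r2}) \<Longrightarrow>
           1 \<le> (\<integral>\<^sup>+ r. \<eta> r \<partial>lebesgue_on {r1<..<r2}) \<Longrightarrow>
           modulus (lifted_paths D f y0 r1 r2)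
             \<le> (\<integral>\<^sup>+ y \<in> f ` D \<inter> annulus y0 r1 r2. Q y * \<eta> (dist y y0) ^ DIM('a) \<partial>lebesgue)"
    unfolding inverse_Poletsky_def by blast
  show thesis
  proof (rule that[OF \<open>r0 > 0\<close>])
    fix r1 r2 :: real assume r: "0 < r1" "r1 < r2" "r2 < r0"
    have "emeasure (lebesgue_on {r1<..<r2}) {r1<..<r2} = ennreal (r2 - r1)"
      using r by (simp add: emeasure_restrict_space)
    then have "(\<integral>\<^sup>+ r. ennreal (1 / (r2 - r1)) \<partial>lebesgue_on {r1<..<r2}) = 1"
      using r by (simp flip: ennreal_mult)
    then have "modulus (lifted_paths D f y0 r1 r2)
        \<le> (\<integral>\<^sup>+ y \<in> f ` D \<inter> annulus y0 r1 r2. Q y * ennreal (1 / (r2 - r1)) ^ DIM('a) \<partial>lebesgue)"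
      using r by (intro r0) auto
    also have "\<dots> \<le> (\<integral>\<^sup>+ y. ennreal (1 / (r2 - r1)) ^ DIM('a) * (Q y * indicator (cball y0 r2) y) \<partial>lebesgue)"
      by (intro nn_integral_mono) (auto simp: annulus_def indicator_def dist_commute mult.commute)
    also have "\<dots> = ennreal (1 / (r2 - r1)) ^ DIM('a) * (\<integral>\<^sup>+ y \<in> cball y0 r2. Q y \<partial>lebesgue)"
      by (intro nn_integral_cmult borel_measurable_times_ennreal Q borel_measurable_indicator) auto
    finally show "modulus (lifted_paths D f y0 r1 r2) \<le> \<dots>" .
  qed
qed

section \<open>Lower bounds for the energy of a density\<close>

lemma nn_integral_lborel_affine:
  fixes g :: "'a::euclidean_space \<Rightarrow> ennreal"
  assumes [measurable]: "g \<in> borel_measurable borel" and c: "c \<noteq> 0"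
  shows "(\<integral>\<^sup>+ x. g x \<partial>lborel) = ennreal (\<bar>c\<bar> ^ DIM('a)) * (\<integral>\<^sup>+ x. g (t + c *\<^sub>R x) \<partial>lborel)"
  by (subst lborel_affine[OF c, of t])
     (simp add: nn_integral_density nn_integral_distr nn_integral_cmult ennreal_power)

text \<open>Where \<open>x\<close> exceeds \<open>\<alpha>\<close>, the factor
  \<open>(x / \<alpha>) ^ (n - 1)\<close> is at least 1, so the second term alone dominates. This
  weak form of Young's inequality replaces Hoelder and covers infinite \<open>x\<close>.\<close>

lemma le_add_power_ennreal:
  fixes x :: ennreal
  assumes "\<alpha> > 0" "n \<ge> 1"
  shows "x \<le> ennreal \<alpha> + ennreal (1 / \<alpha> ^ (n - 1)) * x ^ n"
proof (cases "x \<le> ennreal \<alpha>")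
  case True
  then show ?thesis by (simp add: add_increasing2)
next
  case False
  have "x = ennreal (1 / \<alpha> ^ (n - 1)) * (x * ennreal \<alpha> ^ (n - 1))"
  proof -
    have "ennreal (1 / \<alpha> ^ (n - 1)) * ennreal \<alpha> ^ (n - 1) = 1"
      using assms by (simp add: ennreal_power flip: ennreal_mult)
    then show ?thesis by (metis mult.commute mult.left_commute mult_1_right)
  qed
  also have "\<dots> \<le> ennreal (1 / \<alpha> ^ (n - 1)) * (x * x ^ (n - 1))"
    using False by (intro mult_left_mono power_mono_ennreal) auto
  also have "x * x ^ (n - 1) = x ^ n" using assms by (cases n) auto
  finally show ?thesis by (simp add: add_increasing)
qed

lemma measurable_segment_integral [measurable]:
  fixes \<rho> :: "'a::euclidean_space \<Rightarrow> ennreal"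
  assumes [measurable]: "\<rho> \<in> borel_measurable borel"
  shows "segment_integral \<rho> p \<in> borel_measurable borel"
  unfolding segment_integral_def by measurable

text \<open>The exponent \<open>1 / n - 1\<close> is the one that balances the two terms of Young's inequality.\<close>

lemma mean_segment_integral_le:
  fixes \<rho> :: "'a::euclidean_space \<Rightarrow> ennreal" and \<beta> \<kappa> :: real
  defines "n \<equiv> DIM('a)"
  assumes [measurable]: "\<rho> \<in> borel_measurable borel" "B \<in> sets borel" and "\<beta> > 0" "\<kappa> \<ge> 0" "R > 0"
    and B: "B \<subseteq> ball p R"
    and good: "\<And>s. s > 0 \<Longrightarrow> (\<integral>\<^sup>+ x \<in> cball p s. \<rho> x ^ n \<partial>lborel) \<le> ennreal (\<kappa> * s)"
  shows "(\<integral>\<^sup>+ z \<in> B. segment_integral \<rho> p z \<partial>lborel)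
           \<le> ennreal (R * n * (\<beta> * unit_ball_vol n * R ^ n + R * \<kappa> / \<beta> ^ (n - 1)))"
proof -
  have n: "n \<ge> 1" by (simp add: n_def Suc_le_eq)
  define K where "K = \<beta> * unit_ball_vol n * R ^ n + R * \<kappa> / \<beta> ^ (n - 1)"
  have K: "K \<ge> 0" using assms by (auto simp: K_def intro!: add_nonneg_nonneg)
  \<comment> \<open>Substituting \<open>x = p + t *\<^sub>R (z - p)\<close> carries \<open>B\<close>
    into the ball of radius \<open>R * t\<close> about \<open>p\<close>, whose energy is at most
    \<open>\<kappa> * (R * t)\<close> by \<open>good\<close>. This decay in \<open>t\<close> makes
    the resulting bound integrable near 0.\<close>
  have inner: "(\<integral>\<^sup>+ z. \<rho> (p + t *\<^sub>R (z - p)) * indicator B z \<partial>lborel) \<le> ennreal (K * t powr (1 / n - 1))"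
    if t: "0 < t" "t \<le> 1" for t
  proof -
    define \<alpha> where "\<alpha> = \<beta> * t powr (1 / n - 1)"
    have \<alpha>: "\<alpha> > 0" using \<open>\<beta> > 0\<close> t by (simp add: \<alpha>_def)
    define C where "C = cball p (R * t)"
    have [measurable]: "C \<in> sets borel" by (simp add: C_def)
    define g where "g x = \<rho> x * indicator (C) x" for x
    have [measurable]: "g \<in> borel_measurable borel" unfolding g_def by measurable
    have "(\<integral>\<^sup>+ x. g x \<partial>lborel) \<le> (\<integral>\<^sup>+ x. ennreal \<alpha> * indicator (C) x +
        ennreal (1 / \<alpha> ^ (n - 1)) * (\<rho> x ^ n * indicator (C) x) \<partial>lborel)"
    proof (intro nn_integral_mono)
      fix x
      show "g x \<le> ennreal \<alpha> * indicator (C) x +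
        ennreal (1 / \<alpha> ^ (n - 1)) * (\<rho> x ^ n * indicator (C) x)"
        using le_add_power_ennreal[OF \<alpha> n, of "\<rho> x"] by (cases "x \<in> C") (simp_all add: g_def)
    qed
    also have "\<dots> = ennreal \<alpha> * emeasure lborel (C) +
        ennreal (1 / \<alpha> ^ (n - 1)) * (\<integral>\<^sup>+ x \<in> C. \<rho> x ^ n \<partial>lborel)"
      by (simp add: nn_integral_add nn_integral_cmult)
    also have "\<dots> \<le> ennreal \<alpha> * ennreal (unit_ball_vol n * (R * t) ^ n) + ennreal (1 / \<alpha> ^ (n - 1)) * ennreal (\<kappa> * (R * t))"
      using t \<open>R > 0\<close> unfolding C_def by (intro add_mono mult_left_mono good) (auto simp: C_def emeasure_cball n_def)
    also have "\<dots> = ennreal (\<alpha> * (unit_ball_vol n * (R * t) ^ n) + 1 / \<alpha> ^ (n - 1) * (\<kappa> * (R * t)))"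
      using t \<alpha> \<open>R > 0\<close> \<open>\<kappa> \<ge> 0\<close> by (simp flip: ennreal_mult ennreal_plus)
    \<comment> \<open>Since \<open>(t powr (1 / n - 1)) ^ n * t ^ n = t\<close>, both terms become
      the Jacobian \<open>t ^ n\<close> times the same singular factor.\<close>
    also have "\<alpha> * (unit_ball_vol n * (R * t) ^ n) + 1 / \<alpha> ^ (n - 1) * (\<kappa> * (R * t)) = t ^ n * (K * t powr (1 / n - 1))"
    proof -
      have "(t powr (1 / n - 1)) ^ (n - 1) * t powr (1 / n - 1) = (t powr (1 / n - 1)) ^ n"
        using n by (cases n) auto
      also have "\<dots> = t powr (1 - real n)"
      proof -
        have "(t powr (1 / n - 1)) ^ n = (t powr (1 / n - 1)) powr n"
          using t by (simp add: powr_realpow)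
        also have "\<dots> = t powr ((1 / n - 1) * n)" by (rule powr_powr)
        also have "(1 / n - 1) * real n = 1 - real n" using n by (simp add: field_simps)
        finally show ?thesis .
      qed
      also have "\<dots> * t ^ n = t"
        using t by (simp add: powr_diff powr_realpow)
      finally have "t = (t powr (1 / n - 1)) ^ (n - 1) * t powr (1 / n - 1) * t ^ n" by simp
      moreover have "(t powr (1 / n - 1)) ^ (n - 1) > 0" using t by simp
      ultimately have "t / (t powr (1 / n - 1)) ^ (n - 1) = t powr (1 / n - 1) * t ^ n"
        by (metis less_numeral_extra(3) mult.assoc nonzero_mult_div_cancel_left)
      moreover have "1 / \<alpha> ^ (n - 1) * (\<kappa> * (R * t)) = R * \<kappa> / \<beta> ^ (n - 1) * (t / (t powr (1 / n - 1)) ^ (n - 1))"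
        by (simp add: \<alpha>_def power_mult_distrib)
      ultimately have "1 / \<alpha> ^ (n - 1) * (\<kappa> * (R * t)) = R * \<kappa> / \<beta> ^ (n - 1) * (t powr (1 / n - 1) * t ^ n)"
        by simp
      then show ?thesis by (simp add: \<alpha>_def K_def power_mult_distrib algebra_simps)
    qed
    finally have le: "(\<integral>\<^sup>+ x. g x \<partial>lborel) \<le> ennreal (t ^ n) * ennreal (K * t powr (1 / n - 1))"
      using t K by (simp add: ennreal_mult)
    have "ennreal (t ^ n) * (\<integral>\<^sup>+ z. \<rho> (p + t *\<^sub>R (z - p)) * indicator B z \<partial>lborel)
        \<le> ennreal (t ^ n) * (\<integral>\<^sup>+ z. g ((p - t *\<^sub>R p) + t *\<^sub>R z) \<partial>lborel)"
    proof (intro mult_left_mono nn_integral_mono)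
      fix z
      have eq: "(p - t *\<^sub>R p) + t *\<^sub>R z = p + t *\<^sub>R (z - p)" by (simp add: algebra_simps)
      have "dist p (p + t *\<^sub>R (z - p)) \<le> R * t" if "z \<in> B"
        using that B t by (auto simp: dist_norm norm_minus_commute subset_iff)
      then show "\<rho> (p + t *\<^sub>R (z - p)) * indicator B z \<le> g ((p - t *\<^sub>R p) + t *\<^sub>R z)"
        unfolding eq g_def C_def by (auto simp: indicator_def)
    qed simp
    also have "\<dots> = (\<integral>\<^sup>+ x. g x \<partial>lborel)"
      using nn_integral_lborel_affine[of g t "p - t *\<^sub>R p"] t by (simp add: n_def)
    also note le
    finally show ?thesis
      using t by (simp add: ennreal_mult_le_mult_iff)
  qed
  have "(\<integral>\<^sup>+ z \<in> B. segment_integral \<rho> p z \<partial>lborel) \<le>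
      (\<integral>\<^sup>+ z. ennreal R * (\<integral>\<^sup>+ t. \<rho> (p + t *\<^sub>R (z - p)) * indicator B z * indicator {0..1} t \<partial>lborel) \<partial>lborel)"
  proof (intro nn_integral_mono)
    fix z
    have "norm (z - p) \<le> R" if "z \<in> B"
    proof -
      have "z \<in> ball p R" using that B by blast
      then show ?thesis by (simp add: dist_norm norm_minus_commute)
    qed
    then have "z \<in> B \<Longrightarrow> segment_integral \<rho> p z \<le> ennreal R * (\<integral>\<^sup>+ t \<in> {0..1}. \<rho> (p + t *\<^sub>R (z - p)) \<partial>lborel)"
      unfolding segment_integral_def by (intro mult_right_mono ennreal_leI) auto
    then show "segment_integral \<rho> p z * indicator B z \<le>
      ennreal R * (\<integral>\<^sup>+ t. \<rho> (p + t *\<^sub>R (z - p)) * indicator B z * indicator {0..1} t \<partial>lborel)"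
      by (cases "z \<in> B") auto
  qed
  also have "\<dots> = ennreal R * (\<integral>\<^sup>+ z. \<integral>\<^sup>+ t. \<rho> (p + t *\<^sub>R (z - p)) * indicator B z * indicator {0..1} t \<partial>lborel \<partial>lborel)"
    by (intro nn_integral_cmult) measurable
  finally have outer: "(\<integral>\<^sup>+ z \<in> B. segment_integral \<rho> p z \<partial>lborel) \<le> \<dots>" .
  have "(\<integral>\<^sup>+ z. \<integral>\<^sup>+ t. \<rho> (p + t *\<^sub>R (z - p)) * indicator B z * indicator {0..1} t \<partial>lborel \<partial>lborel) =
      (\<integral>\<^sup>+ t. \<integral>\<^sup>+ z. \<rho> (p + t *\<^sub>R (z - p)) * indicator B z * indicator {0..1} t \<partial>lborel \<partial>lborel)"
    by (rule lborel_pair.Fubini'[symmetric]) measurable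
  also have "\<dots> = (\<integral>\<^sup>+ t. (\<integral>\<^sup>+ z. \<rho> (p + t *\<^sub>R (z - p)) * indicator B z \<partial>lborel) * indicator {0..1} t \<partial>lborel)"
    by (intro nn_integral_cong nn_integral_multc) measurable
  also have "\<dots> \<le> (\<integral>\<^sup>+ t. ennreal (K * t powr (1 / n - 1)) * indicator {0..1} t \<partial>lborel)"
  proof (rule nn_integral_mono_AE)
    \<comment> \<open>At \<open>t = 0\<close> the bound degenerates to 0, because
      \<open>0 powr _\<close> is 0; this single point is discarded as a null set.\<close>
    have "AE t in lborel. t \<noteq> (0::real)" by (rule AE_lborel_singleton)
    then show "AE t in lborel. (\<integral>\<^sup>+ z. \<rho> (p + t *\<^sub>R (z - p)) * indicator B z \<partial>lborel) * indicator {0..1} t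
        \<le> ennreal (K * t powr (1 / n - 1)) * indicator {0..1} t"
      by eventually_elim (use inner in \<open>auto simp: indicator_def\<close>)
  qed
  also have "\<dots> = ennreal (K * n)"
  proof (rule nn_integral_has_integral_lebesgue')
    \<comment> \<open>The exponent exceeds -1, so the integral converges, with value
      \<open>1 / (1 / n) = n\<close>.\<close>
    have "((\<lambda>t::real. t powr (1 / n - 1)) has_integral (1 powr (1 / n - 1 + 1) / (1 / n - 1 + 1))) {0..1}"
      using n by (intro has_integral_powr_from_0) auto
    then have "((\<lambda>t::real. t powr (1 / n - 1)) has_integral n) {0..1}"
      by simp
    then show "((\<lambda>t::real. K * t powr (1 / n - 1)) has_integral K * n) {0..1}"
      by (rule has_integral_mult_right)
  qed (use K in auto)
  finally have "ennreal R * (\<integral>\<^sup>+ z. \<integral>\<^sup>+ t. \<rho> (p + t *\<^sub>R (z - p)) * indicator B z * indicator {0..1} t \<partial>lborel \<partial>lborel)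
      \<le> ennreal R * ennreal (K * n)"
    by (intro mult_left_mono) auto
  also have "ennreal R * ennreal (K * n) = ennreal (R * n * K)"
    using K \<open>R > 0\<close> by (simp add: mult_ac flip: ennreal_mult)
  finally show ?thesis
    using outer unfolding K_def by (rule order_trans[rotated])
qed

text \<open>Otherwise each point of \<open>E\<close> with norm in \<open>[1, 2]\<close> is the
  centre of a ball of some radius \<open>s\<close> carrying mass above \<open>\<kappa> * s\<close>.
  Vitali's lemma selects disjoint ones whose fivefold enlargements still cover all the points. The
  norm is 1-Lipschitz, so intervals of length \<open>10 * s\<close> cover \<open>[1, 2]\<close>;
  hence the radii add up to at least 1/10 and the total mass is at least
  \<open>\<kappa> / 10\<close>.\<close>

lemma good_point:
  fixes g :: "'a::euclidean_space \<Rightarrow> ennreal"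
  assumes [measurable]: "g \<in> borel_measurable borel" and "\<kappa> > 0"
    and small: "(\<integral>\<^sup>+ x. g x \<partial>lborel) < ennreal (\<kappa> / 10)"
    and E: "\<And>\<tau>. 1 \<le> \<tau> \<Longrightarrow> \<tau> \<le> 2 \<Longrightarrow> \<exists>x\<in>E. norm x = \<tau>"
  obtains x where "x \<in> E" "1 \<le> norm x" "norm x \<le> 2"
    "\<And>s. s > 0 \<Longrightarrow> (\<integral>\<^sup>+ y \<in> cball x s. g y \<partial>lborel) \<le> ennreal (\<kappa> * s)"
proof (rule ccontr)
  assume "\<not> thesis"
  define E' where "E' = {x \<in> E. 1 \<le> norm x \<and> norm x \<le> 2}"
  have "\<forall>x\<in>E'. \<exists>s>0. ennreal (\<kappa> * s) < (\<integral>\<^sup>+ y \<in> cball x s. g y \<partial>lborel)"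
    using \<open>\<not> thesis\<close> that unfolding E'_def by force
  then obtain s where s: "\<And>x. x \<in> E' \<Longrightarrow> 0 < s x"
    and bad: "\<And>x. x \<in> E' \<Longrightarrow> ennreal (\<kappa> * s x) < (\<integral>\<^sup>+ y \<in> cball x (s x). g y \<partial>lborel)"
    by metis
  \<comment> \<open>Vitali's lemma needs bounded radii; the small total mass supplies the
    bound.\<close>
  have "s x \<le> 1" if "x \<in> E'" for x
  proof -
    have "(\<integral>\<^sup>+ y \<in> cball x (s x). g y \<partial>lborel) \<le> (\<integral>\<^sup>+ y. g y \<partial>lborel)"
      by (intro nn_integral_mono) (auto simp: indicator_def)
    with bad[OF that] small have "ennreal (\<kappa> * s x) < ennreal (\<kappa> / 10)" by order
    then have "\<kappa> * s x < \<kappa> / 10" using s[OF that] \<open>\<kappa> > 0\<close> by (simp add: ennreal_less_iff)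
    also have "\<dots> \<le> \<kappa> * 1" using \<open>\<kappa> > 0\<close> by simp
    finally show ?thesis using \<open>\<kappa> > 0\<close> by simp
  qed
  with s have s1: "0 < s x \<and> s x \<le> 1" if "x \<in> E'" for x using that by blast
  have "\<exists>C\<subseteq>E'. pairwise (\<lambda>i j. disjnt (cball i (s i)) (cball j (s j))) C \<and>
      (\<forall>x\<in>E'. \<exists>y\<in>C. cball x (s x) \<subseteq> ball y (5 * s y))"
  proof (rule Vitali_covering_lemma_cballs_balls[of E' s 1 "\<lambda>x. x", OF s1])
    fix C assume "C \<subseteq> E'" "pairwise (\<lambda>i j. disjnt (cball i (s i)) (cball j (s j))) C"
      and cov: "\<And>i. i \<in> E' \<Longrightarrow> \<exists>j. j \<in> C \<and> \<not> disjnt (cball i (s i)) (cball j (s j)) \<and> cball i (s i) \<subseteq> ball j (5 * s j)"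
    moreover have "\<exists>y\<in>C. cball x (s x) \<subseteq> ball y (5 * s y)" if "x \<in> E'" for x
      using cov[OF that] by blast
    ultimately show ?thesis by blast
  qed
  then obtain C where C: "C \<subseteq> E'" "pairwise (\<lambda>i j. disjnt (cball i (s i)) (cball j (s j))) C"
    and cov: "\<And>x. x \<in> E' \<Longrightarrow> \<exists>y\<in>C. cball x (s x) \<subseteq> ball y (5 * s y)"
    by blast
  have "{1..2::real} \<subseteq> (\<Union>y\<in>C. ball (norm y) (5 * s y))"
  proof
    fix \<tau> :: real assume "\<tau> \<in> {1..2}"
    then obtain x where x: "x \<in> E'" "norm x = \<tau>" using E[of \<tau>] by (auto simp: E'_def)
    then obtain y where y: "y \<in> C" "cball x (s x) \<subseteq> ball y (5 * s y)" using cov by blast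
    moreover have "x \<in> cball x (s x)" using s[OF x(1)] by simp
    ultimately have "x \<in> ball y (5 * s y)" by blast
    then have "dist y x < 5 * s y" by simp
    then have "\<bar>norm y - norm x\<bar> < 5 * s y"
      using norm_triangle_ineq3[of y x] by (simp add: dist_norm)
    with x y show "\<tau> \<in> (\<Union>y\<in>C. ball (norm y) (5 * s y))" by (auto simp: dist_real_def)
  qed
  then obtain C' where C': "C' \<subseteq> C" "finite C'" "{1..2::real} \<subseteq> (\<Union>y\<in>C'. ball (norm y) (5 * s y))"
    by (rule compactE_image[OF compact_Icc, rotated]) auto
  have spos: "s y > 0" if "y \<in> C'" for y using that C' C s by blast
  have "ennreal 1 = emeasure lborel {1..2::real}" by simp
  also have "\<dots> \<le> emeasure lborel (\<Union>y\<in>C'. ball (norm y) (5 * s y))"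
    using C' by (intro emeasure_mono) auto
  also have "\<dots> \<le> (\<Sum>y\<in>C'. emeasure lborel (ball (norm y) (5 * s y)))"
    using C' by (intro emeasure_subadditive_finite) auto
  also have "\<dots> = (\<Sum>y\<in>C'. ennreal (10 * s y))"
    using spos by (intro sum.cong refl) (simp add: ball_eq_greaterThanLessThan less_imp_le)
  also have "\<dots> = ennreal (\<Sum>y\<in>C'. 10 * s y)"
    using spos by (intro sum_ennreal) (simp add: less_imp_le)
  finally have "1 \<le> (\<Sum>y\<in>C'. 10 * s y)"
    using spos by (subst (asm) ennreal_le_iff) (auto intro!: sum_nonneg simp: less_imp_le)
  then have "1 \<le> 10 * sum s C'" by (simp add: sum_distrib_left)
  then have "\<kappa> / 10 \<le> (\<Sum>y\<in>C'. \<kappa> * s y)"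
    using \<open>\<kappa> > 0\<close> by (simp add: field_simps flip: sum_distrib_left)
  then have "ennreal (\<kappa> / 10) \<le> ennreal (\<Sum>y\<in>C'. \<kappa> * s y)" by (rule ennreal_leI)
  also have "\<dots> = (\<Sum>y\<in>C'. ennreal (\<kappa> * s y))"
    using spos \<open>\<kappa> > 0\<close> by (intro sum_ennreal[symmetric]) (simp add: less_imp_le)
  also have "\<dots> \<le> (\<Sum>y\<in>C'. emeasure (density lborel g) (cball y (s y)))"
    using bad C C' by (intro sum_mono) (auto simp: emeasure_density less_imp_le)
  also have "\<dots> = emeasure (density lborel g) (\<Union>y\<in>C'. cball y (s y))"
  proof (intro sum_emeasure)
    show "disjoint_family_on (\<lambda>y. cball y (s y)) C'"
      using C(2) C'(1) by (auto simp: disjoint_family_on_def pairwise_def disjnt_def)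
  qed (use C' in auto)
  also have "\<dots> \<le> emeasure (density lborel g) UNIV"
    by (intro emeasure_mono) auto
  also have "\<dots> = (\<integral>\<^sup>+ x. g x \<partial>lborel)"
    by (simp add: emeasure_density)
  finally show False using small by simp
qed

text \<open>In dimension at least 2 some direction is orthogonal to \<open>x\<close>, and its sign
  is free to suit \<open>y\<close>. The half-space so found contains both points, and segments from
  them to a ball far out in direction \<open>e\<close> keep away from the origin.\<close>

lemma exists_unit_inner_nonneg:
  fixes x y :: "'a::euclidean_space"
  assumes "DIM('a) \<ge> 2"
  obtains e where "norm e = 1" "x \<bullet> e = 0" "y \<bullet> e \<ge> 0"
proof -
  obtain v where v: "v \<noteq> 0" "x \<bullet> v = 0"
    using orthogonal_to_vector_exists[OF assms, of x] by (auto simp: orthogonal_def)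
  show thesis
  proof (cases "y \<bullet> v \<ge> 0")
    case True
    then show ?thesis using that[of "v /\<^sub>R norm v"] v by simp
  next
    case False
    then show ?thesis using that[of "- (v /\<^sub>R norm v)"] v by (simp add: mult_nonneg_nonpos)
  qed
qed


text \<open>While \<open>t < 1/10\<close> the end \<open>x\<close> dominates:
  \<open>9/10 - 13/40 > 1/4\<close>. Afterwards the component along \<open>e\<close> is at least
  \<open>11/40\<close>.\<close>

lemma norm_segment_gt_quarter:
  fixes x z e :: "'a::euclidean_space"
  assumes e: "norm e = 1" "x \<bullet> e \<ge> 0" and x: "1 \<le> norm x" and z: "norm z \<le> 13/4" "z \<bullet> e \<ge> 11/4"
    and t: "0 \<le> t" "t \<le> 1"
  shows "1/4 < norm (x + t *\<^sub>R (z - x))"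
proof (cases "t < 1/10")
  case True
  have "t * norm z \<le> (1/10) * (13/4)" using True t z by (intro mult_mono) auto
  moreover have "(9/10) * 1 \<le> (1 - t) * norm x" using True t x by (intro mult_mono) auto
  moreover have "norm ((1 - t) *\<^sub>R x) - norm (t *\<^sub>R z) \<le> norm ((1 - t) *\<^sub>R x + t *\<^sub>R z)"
    by (rule norm_diff_ineq)
  moreover have "x + t *\<^sub>R (z - x) = (1 - t) *\<^sub>R x + t *\<^sub>R z" by (simp add: algebra_simps)
  ultimately show ?thesis using t by simp
next
  case False
  have "(1/10) * (11/4) \<le> t * (z \<bullet> e)" using False z by (intro mult_mono) auto
  moreover have "0 \<le> (1 - t) * (x \<bullet> e)" using t e by simp
  moreover have "(x + t *\<^sub>R (z - x)) \<bullet> e = (1 - t) * (x \<bullet> e) + t * (z \<bullet> e)"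
    by (simp add: algebra_simps)
  moreover have "(x + t *\<^sub>R (z - x)) \<bullet> e \<le> norm (x + t *\<^sub>R (z - x))"
    using norm_cauchy_schwarz[of "x + t *\<^sub>R (z - x)" e] e by simp
  ultimately show ?thesis by simp
qed

text \<open>Suppose the energy in the annulus is too small. Pick a good point in each of
  \<open>E\<close> and \<open>F\<close> and average the segment integrals to \<open>z\<close> over a
  small ball \<open>B\<close> of volume \<open>b\<close>. Each average is then at most
  \<open>c * b / 4\<close>, whereas the hypothesis forces their sum to be at least
  \<open>c * b\<close>. The segments in question never leave the annulus, so \<open>\<rho>\<close>
  may be cut off outside it.\<close>

lemma annulus_loewner:
  assumes dim: "DIM('a::euclidean_space) \<ge> 2" and "c > 0"
  obtains \<kappa> where "\<kappa> > 0"
    "\<And>(\<rho> :: 'a \<Rightarrow> ennreal) E F. \<rho> \<in> borel_measurable borel \<Longrightarrow>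
       (\<And>\<tau>. 1 \<le> \<tau> \<Longrightarrow> \<tau> \<le> 2 \<Longrightarrow> \<exists>x\<in>E. norm x = \<tau>) \<Longrightarrow>
       (\<And>\<tau>. 1 \<le> \<tau> \<Longrightarrow> \<tau> \<le> 2 \<Longrightarrow> \<exists>x\<in>F. norm x = \<tau>) \<Longrightarrow>
       (\<And>x y z. x \<in> E \<Longrightarrow> y \<in> F \<Longrightarrow> norm x \<le> 2 \<Longrightarrow> norm y \<le> 2 \<Longrightarrow> norm z < 4 \<Longrightarrow>
          ennreal c \<le> segment_integral \<rho> x z + segment_integral \<rho> y z) \<Longrightarrow>
       ennreal \<kappa> \<le> (\<integral>\<^sup>+ x \<in> {x. 1/4 < norm x \<and> norm x < 4}. \<rho> x ^ DIM('a) \<partial>lborel)"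
proof -
  define n where "n = DIM('a)"
  define \<omega> where "\<omega> = unit_ball_vol n"
  define b where "b = \<omega> * (1/4) ^ n"
  \<comment> \<open>\<open>\<beta>\<close> and \<open>\<kappa>\<close> make each of the two terms in
    \<open>mean_segment_integral_le\<close>, taken with \<open>R = 6\<close>, equal to
    \<open>c * b / 8\<close>. The radius 6 works because \<open>2 + 13/4 < 6\<close>.\<close>
  define \<beta> where "\<beta> = c * b / (48 * n * \<omega> * 6 ^ n)"
  define \<kappa> where "\<kappa> = c * b * \<beta> ^ (n - 1) / (48 * n * 6)"
  have n: "n \<ge> 2" using dim by (simp add: n_def)
  have "\<omega> > 0" by (simp add: \<omega>_def)
  have "b > 0" using \<open>\<omega> > 0\<close> by (simp add: b_def)
  have "\<beta> > 0" using \<open>\<omega> > 0\<close> \<open>b > 0\<close> \<open>c > 0\<close> n by (simp add: \<beta>_def)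
  have "\<kappa> > 0" using \<open>\<beta> > 0\<close> \<open>b > 0\<close> \<open>c > 0\<close> n by (simp add: \<kappa>_def)
  have mean: "6 * n * (\<beta> * \<omega> * 6 ^ n + 6 * \<kappa> / \<beta> ^ (n - 1)) = c * b / 4"
  proof -
    have "6 * n * (\<beta> * \<omega> * 6 ^ n) = c * b / 8"
      using n \<open>\<omega> > 0\<close> by (simp add: \<beta>_def)
    moreover have "6 * n * (6 * \<kappa> / \<beta> ^ (n - 1)) = c * b / 8"
      using n \<open>\<beta> > 0\<close> by (simp add: \<kappa>_def)
    ultimately show ?thesis by (simp add: distrib_left)
  qed
  show thesis
  proof (rule that[of "\<kappa> / 10"])
    show "\<kappa> / 10 > 0" using \<open>\<kappa> > 0\<close> by simp
    fix \<rho> :: "'a \<Rightarrow> ennreal" and E F :: "'a set"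
    assume [measurable]: "\<rho> \<in> borel_measurable borel"
      and E: "\<And>\<tau>. 1 \<le> \<tau> \<Longrightarrow> \<tau> \<le> 2 \<Longrightarrow> \<exists>x\<in>E. norm x = \<tau>"
      and F: "\<And>\<tau>. 1 \<le> \<tau> \<Longrightarrow> \<tau> \<le> 2 \<Longrightarrow> \<exists>x\<in>F. norm x = \<tau>"
      and c: "\<And>x y z. x \<in> E \<Longrightarrow> y \<in> F \<Longrightarrow> norm x \<le> 2 \<Longrightarrow> norm y \<le> 2 \<Longrightarrow> norm z < 4 \<Longrightarrow>
          ennreal c \<le> segment_integral \<rho> x z + segment_integral \<rho> y z"
    define A where "A = {x :: 'a. 1/4 < norm x \<and> norm x < 4}"
    have [measurable]: "A \<in> sets borel" unfolding A_def by measurable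
    define \<sigma> where "\<sigma> x = \<rho> x * indicator A x" for x
    have [measurable]: "\<sigma> \<in> borel_measurable borel" unfolding \<sigma>_def by measurable
    have \<sigma>_int: "(\<integral>\<^sup>+ x. \<sigma> x ^ n \<partial>lborel) = (\<integral>\<^sup>+ x \<in> A. \<rho> x ^ n \<partial>lborel)"
      using n by (intro nn_integral_cong) (auto simp: \<sigma>_def indicator_def power_0_left)
    show "ennreal (\<kappa> / 10) \<le> (\<integral>\<^sup>+ x \<in> {x. 1/4 < norm x \<and> norm x < 4}. \<rho> x ^ DIM('a) \<partial>lborel)"
    proof (rule ccontr)
      assume "\<not> ?thesis"
      then have small: "(\<integral>\<^sup>+ x. \<sigma> x ^ n \<partial>lborel) < ennreal (\<kappa> / 10)"
        unfolding \<sigma>_int unfolding A_def n_def by (rule not_le_imp_less)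
      have "(\<lambda>x. \<sigma> x ^ n) \<in> borel_measurable borel" by measurable
      note good = good_point[OF this \<open>\<kappa> > 0\<close> small]
      from good[OF E] obtain x where x: "x \<in> E" "1 \<le> norm x" "norm x \<le> 2"
        and gx: "\<And>s. s > 0 \<Longrightarrow> (\<integral>\<^sup>+ y \<in> cball x s. \<sigma> y ^ n \<partial>lborel) \<le> ennreal (\<kappa> * s)" by blast
      from good[OF F] obtain y where y: "y \<in> F" "1 \<le> norm y" "norm y \<le> 2"
        and gy: "\<And>s. s > 0 \<Longrightarrow> (\<integral>\<^sup>+ z \<in> cball y s. \<sigma> z ^ n \<partial>lborel) \<le> ennreal (\<kappa> * s)" by blast
      obtain e where e: "norm e = 1" "x \<bullet> e = 0" "y \<bullet> e \<ge> 0"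
        using exists_unit_inner_nonneg[OF dim] by blast
      define B where "B = ball (3 *\<^sub>R e) (1/4)"
      have [measurable]: "B \<in> sets borel" by (simp add: B_def)
      have z: "norm z < 13/4" "z \<bullet> e \<ge> 11/4" if "z \<in> B" for z
      proof -
        have d: "norm (z - 3 *\<^sub>R e) < 1/4" using that by (simp add: B_def dist_norm norm_minus_commute)
        have "norm z \<le> norm (z - 3 *\<^sub>R e) + norm (3 *\<^sub>R e)"
          using norm_triangle_ineq[of "z - 3 *\<^sub>R e" "3 *\<^sub>R e"] by simp
        with d e show "norm z < 13/4" by simp
        have "- (1/4) \<le> (z - 3 *\<^sub>R e) \<bullet> e"
          using Cauchy_Schwarz_ineq2[of "z - 3 *\<^sub>R e" e] d e by simp
        then show "z \<bullet> e \<ge> 11/4" using e by (simp add: inner_diff_left dot_square_norm)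
      qed
      have eq: "segment_integral \<rho> w z = segment_integral \<sigma> w z"
        if w: "1 \<le> norm w" "norm w \<le> 2" "w \<bullet> e \<ge> 0" and "z \<in> B" for w z
      proof -
        have "w + t *\<^sub>R (z - w) \<in> A" if t: "0 \<le> t" "t \<le> 1" for t
        proof -
          have "w \<in> ball 0 4" "z \<in> ball 0 4" using w z[OF \<open>z \<in> B\<close>] by auto
          then have "w + t *\<^sub>R (z - w) \<in> ball 0 4"
            using t convexD_alt[OF convex_ball, of w 0 4 z t] by (simp add: algebra_simps)
          moreover have "1/4 < norm (w + t *\<^sub>R (z - w))"
            using w z[OF \<open>z \<in> B\<close>] t e by (intro norm_segment_gt_quarter) auto
          ultimately show ?thesis by (simp add: A_def)
        qed
        then have "(\<integral>\<^sup>+ t \<in> {0..1}. \<rho> (w + t *\<^sub>R (z - w)) \<partial>lborel) = (\<integral>\<^sup>+ t \<in> {0..1}. \<sigma> (w + t *\<^sub>R (z - w)) \<partial>lborel)"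
          by (intro nn_integral_cong) (auto simp: \<sigma>_def indicator_def)
        then show ?thesis by (simp add: segment_integral_def)
      qed
      have sub: "B \<subseteq> ball w 6" if "norm w \<le> 2" for w
      proof
        fix u assume "u \<in> B"
        then show "u \<in> ball w 6" using z(1)[of u] norm_triangle_ineq4[of w u] that by (simp add: dist_norm)
      qed
      have le: "(\<integral>\<^sup>+ z \<in> B. segment_integral \<sigma> w z \<partial>lborel) \<le> ennreal (c * b / 4)"
        if "norm w \<le> 2" "\<And>s. s > 0 \<Longrightarrow> (\<integral>\<^sup>+ y \<in> cball w s. \<sigma> y ^ n \<partial>lborel) \<le> ennreal (\<kappa> * s)" for w
        using mean_segment_integral_le[of \<sigma> B \<beta> \<kappa> 6 w] that sub[of w] \<open>\<beta> > 0\<close> \<open>\<kappa> > 0\<close>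
        by (simp add: mean[symmetric] n_def \<omega>_def)
      have "ennreal (c * b) = (\<integral>\<^sup>+ z \<in> B. ennreal c \<partial>lborel)"
        using \<open>c > 0\<close> \<open>b > 0\<close> by (simp add: nn_integral_cmult_indicator B_def emeasure_ball b_def \<omega>_def n_def ennreal_mult)
      also have "\<dots> \<le> (\<integral>\<^sup>+ z. segment_integral \<sigma> x z * indicator B z + segment_integral \<sigma> y z * indicator B z \<partial>lborel)"
      proof (intro nn_integral_mono)
        fix w
        show "ennreal c * indicator B w \<le> segment_integral \<sigma> x w * indicator B w + segment_integral \<sigma> y w * indicator B w"
          using c[OF x(1) y(1) x(3) y(3), of w] z(1)[of w] eq[of x w] eq[of y w] x y e
          by (cases "w \<in> B") auto
      qed
      also have "\<dots> = (\<integral>\<^sup>+ z \<in> B. segment_integral \<sigma> x z \<partial>lborel) + (\<integral>\<^sup>+ z \<in> B. segment_integral \<sigma> y z \<partial>lborel)"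
        by (intro nn_integral_add) measurable
      also have "\<dots> \<le> ennreal (c * b / 4) + ennreal (c * b / 4)"
        by (intro add_mono le x y gx gy)
      also have "\<dots> = ennreal (c * b / 2)"
        using \<open>c > 0\<close> \<open>b > 0\<close> by (simp flip: ennreal_plus)
      finally show False
        using \<open>c > 0\<close> \<open>b > 0\<close> by simp
    qed
  qed
qed

section \<open>Scaling and accumulation over concentric rings\<close>

lemma segment_integral_homothety:
  fixes \<rho> :: "'a::euclidean_space \<Rightarrow> ennreal"
  assumes [measurable]: "\<rho> \<in> borel_measurable borel" and "t > 0"
  shows "segment_integral (\<lambda>x. ennreal t * \<rho> (x0 + t *\<^sub>R x)) p q =
           segment_integral \<rho> (x0 + t *\<^sub>R p) (x0 + t *\<^sub>R q)"
proof -
  have "x0 + t *\<^sub>R (p + s *\<^sub>R (q - p)) = (x0 + t *\<^sub>R p) + s *\<^sub>R ((x0 + t *\<^sub>R q) - (x0 + t *\<^sub>R p))" for s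
    by (simp add: algebra_simps)
  moreover have "norm ((x0 + t *\<^sub>R q) - (x0 + t *\<^sub>R p)) = t * norm (q - p)"
    using \<open>t > 0\<close> by (simp flip: scaleR_diff_right)
  moreover have "(\<integral>\<^sup>+ s \<in> {0..1}. ennreal t * \<rho> (x0 + t *\<^sub>R (p + s *\<^sub>R (q - p))) \<partial>lborel) =
      ennreal t * (\<integral>\<^sup>+ s \<in> {0..1}. \<rho> (x0 + t *\<^sub>R (p + s *\<^sub>R (q - p))) \<partial>lborel)"
    by (simp add: mult.assoc nn_integral_cmult)
  ultimately show ?thesis
    using \<open>t > 0\<close> by (simp add: segment_integral_def ennreal_mult mult_ac add.assoc)
qed

text \<open>The energy with exponent \<open>DIM('a)\<close> is invariant under homotheties: the
  factor \<open>t j\<close> on the pulled-back density preserves segment integrals, and its power is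
  the Jacobian. Hence \<open>annulus_loewner\<close> yields the same \<open>\<kappa>\<close> at each
  radius \<open>t j = 16 ^ j * \<delta>\<close>. The ring there reaches from \<open>t j / 4\<close>
  to \<open>4 * t j\<close>, so the ratio 16 makes the rings disjoint and the contributions add
  up.\<close>

lemma loewner_log:
  assumes dim: "DIM('a::euclidean_space) \<ge> 2" and "c > 0"
  obtains \<kappa> where "\<kappa> > 0"
    "\<And>(\<rho> :: 'a \<Rightarrow> ennreal) E F x0 \<delta> J. \<rho> \<in> borel_measurable borel \<Longrightarrow> \<delta> > 0 \<Longrightarrow>
       (\<And>\<tau>. \<delta> \<le> \<tau> \<Longrightarrow> \<tau> \<le> 16 ^ J * \<delta> \<Longrightarrow> \<exists>x\<in>E. dist x x0 = \<tau>) \<Longrightarrow>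
       (\<And>\<tau>. \<delta> \<le> \<tau> \<Longrightarrow> \<tau> \<le> 16 ^ J * \<delta> \<Longrightarrow> \<exists>x\<in>F. dist x x0 = \<tau>) \<Longrightarrow>
       (\<And>x y z. x \<in> E \<Longrightarrow> y \<in> F \<Longrightarrow> x \<in> ball x0 (16 ^ J * \<delta>) \<Longrightarrow> y \<in> ball x0 (16 ^ J * \<delta>) \<Longrightarrow>
          z \<in> ball x0 (16 ^ J * \<delta>) \<Longrightarrow> ennreal c \<le> segment_integral \<rho> x z + segment_integral \<rho> y z) \<Longrightarrow>
       ennreal (real J * \<kappa>) \<le> (\<integral>\<^sup>+ x. \<rho> x ^ DIM('a) \<partial>lborel)"
proof -
  obtain \<kappa> where "\<kappa> > 0" and \<kappa>:
    "\<And>(\<rho> :: 'a \<Rightarrow> ennreal) E F. \<rho> \<in> borel_measurable borel \<Longrightarrow>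
       (\<And>\<tau>. 1 \<le> \<tau> \<Longrightarrow> \<tau> \<le> 2 \<Longrightarrow> \<exists>x\<in>E. norm x = \<tau>) \<Longrightarrow>
       (\<And>\<tau>. 1 \<le> \<tau> \<Longrightarrow> \<tau> \<le> 2 \<Longrightarrow> \<exists>x\<in>F. norm x = \<tau>) \<Longrightarrow>
       (\<And>x y z. x \<in> E \<Longrightarrow> y \<in> F \<Longrightarrow> norm x \<le> 2 \<Longrightarrow> norm y \<le> 2 \<Longrightarrow> norm z < 4 \<Longrightarrow>
          ennreal c \<le> segment_integral \<rho> x z + segment_integral \<rho> y z) \<Longrightarrow>
       ennreal \<kappa> \<le> (\<integral>\<^sup>+ x \<in> {x. 1/4 < norm x \<and> norm x < 4}. \<rho> x ^ DIM('a) \<partial>lborel)"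
    using annulus_loewner[OF assms] by blast
  show thesis
  proof (rule that[OF \<open>\<kappa> > 0\<close>])
    fix \<rho> :: "'a \<Rightarrow> ennreal" and E F :: "'a set" and x0 \<delta> J
    assume [measurable]: "\<rho> \<in> borel_measurable borel" and "\<delta> > (0::real)"
      and E: "\<And>\<tau>. \<delta> \<le> \<tau> \<Longrightarrow> \<tau> \<le> 16 ^ J * \<delta> \<Longrightarrow> \<exists>x\<in>E. dist x x0 = \<tau>"
      and F: "\<And>\<tau>. \<delta> \<le> \<tau> \<Longrightarrow> \<tau> \<le> 16 ^ J * \<delta> \<Longrightarrow> \<exists>x\<in>F. dist x x0 = \<tau>"
      and c: "\<And>x y z. x \<in> E \<Longrightarrow> y \<in> F \<Longrightarrow> x \<in> ball x0 (16 ^ J * \<delta>) \<Longrightarrow> y \<in> ball x0 (16 ^ J * \<delta>) \<Longrightarrow>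
          z \<in> ball x0 (16 ^ J * \<delta>) \<Longrightarrow> ennreal c \<le> segment_integral \<rho> x z + segment_integral \<rho> y z"
    define t where "t j = 16 ^ j * \<delta>" for j :: nat
    have tpos: "t j > 0" for j using \<open>\<delta> > 0\<close> by (simp add: t_def)
    define A where "A j = {x. t j / 4 < dist x x0 \<and> dist x x0 < 4 * t j}" for j
    have [measurable]: "A j \<in> sets borel" for j unfolding A_def by measurable
    have bound: "ennreal \<kappa> \<le> (\<integral>\<^sup>+ x \<in> A j. \<rho> x ^ DIM('a) \<partial>lborel)" if "j < J" for j
    proof -
      define h where "h x = x0 + t j *\<^sub>R x" for x
      have dh: "dist (h x) x0 = t j * norm x" for x
        using tpos[of j] by (simp add: h_def dist_norm)
      have "16 * t j = 16 ^ Suc j * \<delta>" by (simp add: t_def)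
      also have "\<dots> \<le> 16 ^ J * \<delta>"
        using that \<open>\<delta> > 0\<close> by (intro mult_right_mono power_increasing) auto
      finally have tJ: "16 * t j \<le> 16 ^ J * \<delta>" .
      have "1 * \<delta> \<le> t j" unfolding t_def using \<open>\<delta> > 0\<close> by (intro mult_right_mono) auto
      then have "\<delta> \<le> t j" by simp
      have pull: "\<exists>x\<in>h -` G. norm x = \<tau>"
        if G: "\<And>\<tau>. \<delta> \<le> \<tau> \<Longrightarrow> \<tau> \<le> 16 ^ J * \<delta> \<Longrightarrow> \<exists>x\<in>G. dist x x0 = \<tau>" and \<tau>: "1 \<le> \<tau>" "\<tau> \<le> 2"
        for G \<tau>
      proof -
        have "t j * 1 \<le> t j * \<tau>" "t j * \<tau> \<le> t j * 2" using \<tau> tpos[of j] by (intro mult_left_mono; simp)+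
        with \<open>\<delta> \<le> t j\<close> tJ tpos[of j] have "\<delta> \<le> t j * \<tau>" "t j * \<tau> \<le> 16 ^ J * \<delta>"
          by linarith+
        from G[OF this] obtain x where x: "x \<in> G" "dist x x0 = t j * \<tau>" by blast
        have "h ((x - x0) /\<^sub>R t j) = x" using tpos[of j] by (simp add: h_def)
        moreover have "norm ((x - x0) /\<^sub>R t j) = \<tau>" using x tpos[of j] by (simp add: dist_norm)
        ultimately show ?thesis using x by (metis vimageI)
      qed
      have "ennreal \<kappa> \<le> (\<integral>\<^sup>+ x \<in> {x. 1/4 < norm x \<and> norm x < 4}. (ennreal (t j) * \<rho> (h x)) ^ DIM('a) \<partial>lborel)"
      proof (rule \<kappa>[of _ "h -` E" "h -` F"])
        show "(\<lambda>x. ennreal (t j) * \<rho> (h x)) \<in> borel_measurable borel" unfolding h_def by measurable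
        show "ennreal c \<le> segment_integral (\<lambda>x. ennreal (t j) * \<rho> (h x)) x z + segment_integral (\<lambda>x. ennreal (t j) * \<rho> (h x)) y z"
          if "x \<in> h -` E" "y \<in> h -` F" "norm x \<le> 2" "norm y \<le> 2" "norm z < 4" for x y z
        proof -
          have "h w \<in> ball x0 (16 ^ J * \<delta>)" if "norm w < 4" for w
          proof -
            have "t j * norm w < t j * 16" using that tpos[of j] by (intro mult_strict_left_mono) auto
            then show ?thesis using dh[of w] tJ by (simp add: dist_commute)
          qed
          then have "ennreal c \<le> segment_integral \<rho> (h x) (h z) + segment_integral \<rho> (h y) (h z)"
            using that by (intro c) auto
          then show ?thesis
            using segment_integral_homothety[of \<rho> "t j" x0] tpos[of j] by (simp add: h_def)
        qed
      qed (use pull E F in blast)+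
      also have "\<dots> = (\<integral>\<^sup>+ x. ennreal (t j ^ DIM('a)) * (\<rho> (h x) ^ DIM('a) * indicator (A j) (h x)) \<partial>lborel)"
      proof (intro nn_integral_cong)
        fix x
        have "h x \<in> A j \<longleftrightarrow> 1/4 < norm x \<and> norm x < 4"
          unfolding A_def using tpos[of j] dh[of x] by (simp add: field_simps)
        then show "(ennreal (t j) * \<rho> (h x)) ^ DIM('a) * indicator {x. 1/4 < norm x \<and> norm x < 4} x =
            ennreal (t j ^ DIM('a)) * (\<rho> (h x) ^ DIM('a) * indicator (A j) (h x))"
          using tpos[of j] by (simp add: indicator_def power_mult_distrib ennreal_power less_imp_le)
      qed
      also have "\<dots> = ennreal (t j ^ DIM('a)) * (\<integral>\<^sup>+ x. \<rho> (h x) ^ DIM('a) * indicator (A j) (h x) \<partial>lborel)"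
        unfolding h_def by (intro nn_integral_cmult) measurable
      also have "\<dots> = (\<integral>\<^sup>+ x \<in> A j. \<rho> x ^ DIM('a) \<partial>lborel)"
        using nn_integral_lborel_affine[of "\<lambda>x. \<rho> x ^ DIM('a) * indicator (A j) x" "t j" x0] tpos[of j]
        by (simp add: h_def)
      finally show ?thesis .
    qed
    have disj: "A i \<inter> A j = {}" if "i < j" for i j
    proof -
      have "16 * t i = 16 ^ Suc i * \<delta>" by (simp add: t_def)
      also have "\<dots> \<le> t j"
        unfolding t_def using that \<open>\<delta> > 0\<close> by (intro mult_right_mono power_increasing) auto
      finally show ?thesis by (auto simp: A_def)
    qed
    have "ennreal (real J * \<kappa>) = (\<Sum>j<J. ennreal \<kappa>)"
      using \<open>\<kappa> > 0\<close> by (simp add: ennreal_mult ennreal_of_nat_eq_real_of_nat)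
    also have "\<dots> \<le> (\<Sum>j<J. emeasure (density lborel (\<lambda>x. \<rho> x ^ DIM('a))) (A j))"
      using bound by (intro sum_mono) (simp add: emeasure_density)
    also have "\<dots> = emeasure (density lborel (\<lambda>x. \<rho> x ^ DIM('a))) (\<Union>j<J. A j)"
    proof (intro sum_emeasure)
      show "disjoint_family_on A {..<J}"
        unfolding disjoint_family_on_def using disj by (metis Int_commute linorder_neqE_nat)
    qed auto
    also have "\<dots> \<le> emeasure (density lborel (\<lambda>x. \<rho> x ^ DIM('a))) UNIV"
      by (intro emeasure_mono) auto
    also have "\<dots> = (\<integral>\<^sup>+ x. \<rho> x ^ DIM('a) \<partial>lborel)"
      by (simp add: emeasure_density)
    finally show "ennreal (real J * \<kappa>) \<le> (\<integral>\<^sup>+ x. \<rho> x ^ DIM('a) \<partial>lborel)" .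
  qed
qed

section \<open>Lifting of continua\<close>

lemma connected_meets_sphere:
  fixes x0 :: "'a::metric_space"
  assumes "connected C" "x \<in> C" "y \<in> C" "dist x x0 \<le> \<tau>" "\<tau> \<le> dist y x0"
  obtains p where "p \<in> C" "dist p x0 = \<tau>"
proof -
  have "connected ((\<lambda>p. dist p x0) ` C)"
    by (intro connected_continuous_image continuous_intros assms)
  then have "\<tau> \<in> (\<lambda>p. dist p x0) ` C"
    using assms by (auto dest: connectedD_interval)
  then show thesis using that by auto
qed

lemma continuum_lift:
  fixes f :: "'a::euclidean_space \<Rightarrow> 'b::t2_space"
  assumes f: "continuous_on D f" and opn: "\<And>U. open U \<Longrightarrow> U \<subseteq> D \<Longrightarrow> open (f ` U)"
    and D: "cball x0 d \<subseteq> D" and x: "x \<in> ball x0 d"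
    and T: "closed T" "connected T" "f x \<in> T" "\<not> T \<subseteq> f ` cball x0 d"
  obtains C where "connected C" "x \<in> C" "C \<subseteq> cball x0 d" "f ` C \<subseteq> T" "C \<inter> sphere x0 d \<noteq> {}"
proof -
  define X where "X = cball x0 d \<inter> f -` T"
  have fd: "continuous_on (cball x0 d) f" using f D by (rule continuous_on_subset)
  have "closedin (top_of_set (cball x0 d)) X"
    unfolding X_def by (intro continuous_closedin_preimage fd T)
  then have X: "compact X" by (rule closedin_compact[OF compact_cball])
  have xX: "x \<in> X" using x T by (auto simp: X_def)
  define C where "C = connected_component_set X x"
  have comp: "C \<in> components X" using xX by (auto simp: C_def components_def)
  have "compact C" using X comp by (rule compact_components)
  have CX: "C \<subseteq> X" unfolding C_def by (rule connected_component_subset)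
  show thesis
  proof (rule that[of C])
    show "connected C" by (simp add: C_def)
    show "x \<in> C" using xX by (simp add: C_def)
    show "C \<subseteq> cball x0 d" "f ` C \<subseteq> T" using CX by (auto simp: X_def)
    show "C \<inter> sphere x0 d \<noteq> {}"
    proof
      assume no: "C \<inter> sphere x0 d = {}"
      have "C \<subseteq> ball x0 d"
      proof
        fix y assume y: "y \<in> C"
        then have "dist x0 y \<le> d" "dist x0 y \<noteq> d" using CX no by (auto simp: X_def)
        then show "y \<in> ball x0 d" by simp
      qed
      then obtain K where K: "openin (top_of_set X) K" "compact K" "C \<subseteq> K" "K \<subseteq> ball x0 d"
        using Sura_Bura_clopen_subset[OF closed_imp_locally_compact[OF compact_imp_closed[OF X]] comp \<open>compact C\<close> open_ball]
        by metis
      from K(1) obtain V where V: "open V" "K = X \<inter> V" by (auto simp: openin_open)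
      have WD: "ball x0 d \<inter> V \<subseteq> D" using D by auto
      then have "open (f ` (ball x0 d \<inter> V))" using V by (intro opn) auto
      \<comment> \<open>A point of \<open>ball x0 d \<inter> V\<close> with value in
        \<open>T\<close> already lies in \<open>X \<inter> V = K\<close>, so intersecting the open
        image with \<open>T\<close> adds nothing.\<close>
      moreover have "f ` K = T \<inter> f ` (ball x0 d \<inter> V)"
        using V K(4) by (auto simp: X_def)
      ultimately have "openin (top_of_set T) (f ` K)" by (auto simp: openin_open)
      moreover have "closedin (top_of_set T) (f ` K)"
      proof -
        have "K \<subseteq> D" using K(4) D ball_subset_cball by blast
        then have "compact (f ` K)" using K(2) f by (meson compact_continuous_image continuous_on_subset)
        then show ?thesis using V by (intro closed_subset compact_imp_closed) (auto simp: X_def)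
      qed
      moreover have "f ` K \<noteq> {}" using K(3) \<open>x \<in> C\<close> by auto
      ultimately have "f ` K = T" using T(2) connected_clopen by blast
      with T(4) K(4) show False by (force simp: subset_iff)
    qed
  qed
qed

section \<open>A global energy bound from rings of small radius\<close>

text \<open>After rescaling, finitely many balls of radius 1/2 cover \<open>cball 0 K\<close>, and
  two separated points cannot share one of them. The bound depends on neither the scale
  \<open>\<delta>\<close> nor the centre \<open>z\<close>.\<close>

lemma separated_card_bound:
  obtains N :: nat where "N > 0" "\<And>\<delta> (z :: 'a::euclidean_space) P. \<delta> > 0 \<Longrightarrow> P \<subseteq> cball z (K * \<delta>) \<Longrightarrow>
     (\<And>p q. p \<in> P \<Longrightarrow> q \<in> P \<Longrightarrow> p \<noteq> q \<Longrightarrow> \<delta> \<le> dist p q) \<Longrightarrow> finite P \<and> card P \<le> N"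
proof -
  have "x \<in> ball x (1/2)" for x :: 'a by simp
  then have "cball (0::'a) K \<subseteq> (\<Union>c\<in>UNIV. ball c (1/2))" by blast
  then obtain F :: "'a set" where F: "finite F" "cball (0::'a) K \<subseteq> (\<Union>c\<in>F. ball c (1/2))"
    by (rule compactE_image[OF compact_cball, rotated]) auto
  show thesis
  proof (rule that[of "Suc (card F)"])
    fix \<delta> and z :: 'a and P
    assume "\<delta> > 0" and P: "P \<subseteq> cball z (K * \<delta>)"
      and sep: "\<And>p q. p \<in> P \<Longrightarrow> q \<in> P \<Longrightarrow> p \<noteq> q \<Longrightarrow> \<delta> \<le> dist p q"
    have "\<exists>c\<in>F. norm (p - z - \<delta> *\<^sub>R c) < \<delta> / 2" if "p \<in> P" for p
    proof -
      have "norm (p - z) \<le> K * \<delta>" using that P by (auto simp: dist_norm norm_minus_commute)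
      moreover have "norm ((p - z) /\<^sub>R \<delta>) = norm (p - z) / \<delta>"
        using \<open>\<delta> > 0\<close> by (simp add: divide_inverse_commute)
      ultimately have "(p - z) /\<^sub>R \<delta> \<in> cball 0 K" using \<open>\<delta> > 0\<close> by (simp add: pos_divide_le_eq)
      then have "(p - z) /\<^sub>R \<delta> \<in> (\<Union>c\<in>F. ball c (1/2))" using F(2) by blast
      then obtain c where c: "c \<in> F" "dist c ((p - z) /\<^sub>R \<delta>) < 1/2"
        unfolding mem_ball[symmetric] by blast
      have "p - z - \<delta> *\<^sub>R c = \<delta> *\<^sub>R ((p - z) /\<^sub>R \<delta> - c)"
        using \<open>\<delta> > 0\<close> by (simp add: scaleR_diff_right)
      then have "norm (p - z - \<delta> *\<^sub>R c) = \<delta> * dist c ((p - z) /\<^sub>R \<delta>)"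
        using \<open>\<delta> > 0\<close> by (simp add: dist_norm norm_minus_commute)
      also have "\<dots> < \<delta> * (1/2)" using c \<open>\<delta> > 0\<close> by (intro mult_strict_left_mono)
      finally show ?thesis using c by auto
    qed
    then obtain c where c: "\<And>p. p \<in> P \<Longrightarrow> c p \<in> F" "\<And>p. p \<in> P \<Longrightarrow> norm (p - z - \<delta> *\<^sub>R c p) < \<delta> / 2"
      by metis
    have "inj_on c P"
    proof (rule inj_onI, rule ccontr)
      fix p q assume pq: "p \<in> P" "q \<in> P" "c p = c q" "p \<noteq> q"
      have "norm ((p - z - \<delta> *\<^sub>R c p) - (q - z - \<delta> *\<^sub>R c q)) < \<delta> / 2 + \<delta> / 2"
        using c(2)[OF pq(1)] c(2)[OF pq(2)] by (intro norm_diff_triangle_less[of _ 0]) (simp_all add: norm_minus_commute)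
      then show False using sep[OF pq(1,2,4)] pq(3) by (simp add: dist_norm)
    qed
    then show "finite P \<and> card P \<le> Suc (card F)"
      using F(1) c(1) by (metis card_inj_on_le image_subsetI inj_on_finite le_SucI)
  qed simp
qed

text \<open>Cardinalities of separated subsets are bounded, so one is largest; a point of
  \<open>T\<close> far from all of it could be added.\<close>

lemma maximal_separated_subset:
  fixes T :: "'a::euclidean_space set"
  assumes "bounded T" "\<delta> > 0"
  obtains P where "finite P" "P \<subseteq> T" "\<And>p q. p \<in> P \<Longrightarrow> q \<in> P \<Longrightarrow> p \<noteq> q \<Longrightarrow> \<delta> \<le> dist p q"
    "\<And>x. x \<in> T \<Longrightarrow> \<exists>p\<in>P. dist x p < \<delta>"
proof -
  obtain R z where R: "T \<subseteq> cball z R" using \<open>bounded T\<close> bounded_subset_cball by blast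
  obtain N where N: "\<And>P. P \<subseteq> cball z (R / \<delta> * \<delta>) \<Longrightarrow>
     (\<And>p q. p \<in> P \<Longrightarrow> q \<in> P \<Longrightarrow> p \<noteq> q \<Longrightarrow> \<delta> \<le> dist p q) \<Longrightarrow> finite P \<and> card P \<le> N"
    using separated_card_bound[of "R / \<delta>"] \<open>\<delta> > 0\<close> by metis
  let ?sep = "\<lambda>P. P \<subseteq> T \<and> (\<forall>p\<in>P. \<forall>q\<in>P. p \<noteq> q \<longrightarrow> \<delta> \<le> dist p q)"
  have fin: "finite P \<and> card P \<le> N" if "?sep P" for P
    using N[of P] that R \<open>\<delta> > 0\<close> by auto
  have "\<exists>P. ?sep P \<and> (\<forall>P'. ?sep P' \<longrightarrow> card P' \<le> card P)"
    by (rule ex_has_greatest_nat[of ?sep "{}" card "Suc N"]) (use fin in \<open>auto simp: less_Suc_eq_le\<close>)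
  then obtain P where P: "?sep P" and max: "\<And>P'. ?sep P' \<Longrightarrow> card P' \<le> card P" by blast
  show thesis
  proof (rule that[of P])
    show "\<exists>p\<in>P. dist x p < \<delta>" if "x \<in> T" for x
    proof (rule ccontr)
      assume far: "\<not> ?thesis"
      then have "x \<notin> P" using \<open>\<delta> > 0\<close> by force
      moreover have "?sep (insert x P)"
        using P far that by (auto simp: not_less dist_commute)
      ultimately show False using max[of "insert x P"] fin[OF P] by simp
    qed
  qed (use P fin in auto)
qed

text \<open>The sum is at most \<open>N\<close> times its largest term, and the power of that term
  is among the summands on the right.\<close>

lemma sum_power_le_card_power:
  fixes a :: "'b \<Rightarrow> ennreal"
  assumes "finite P" "card {p \<in> P. a p \<noteq> 0} \<le> N" "n \<ge> 1"
  shows "(\<Sum>p\<in>P. a p) ^ n \<le> of_nat N ^ n * (\<Sum>p\<in>P. a p ^ n)"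
proof (cases "{p \<in> P. a p \<noteq> 0} = {}")
  case True
  then have "(\<Sum>p\<in>P. a p) = 0" using assms by (auto intro: sum.neutral)
  then show ?thesis using assms by (simp add: power_0_left)
next
  case False
  define P0 where "P0 = {p \<in> P. a p \<noteq> 0}"
  have P0: "finite P0" "P0 \<noteq> {}" using False assms by (auto simp: P0_def)
  obtain m where m: "m \<in> P0" "a m = Max (a ` P0)"
    using Max_in[of "a ` P0"] P0 by fastforce
  have "(\<Sum>p\<in>P. a p) = (\<Sum>p\<in>P0. a p)"
    using assms by (intro sum.mono_neutral_right) (auto simp: P0_def)
  also have "\<dots> \<le> of_nat (card P0) * a m"
    using P0 m by (intro sum_bounded_above) auto
  also have "\<dots> \<le> of_nat N * a m"
    using assms by (intro mult_right_mono) (auto simp: P0_def)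
  finally have "(\<Sum>p\<in>P. a p) ^ n \<le> of_nat N ^ n * a m ^ n"
    by (metis power_mono_ennreal power_mult_distrib)
  also have "a m ^ n \<le> (\<Sum>p\<in>P. a p ^ n)"
    using m assms by (intro member_le_sum) (auto simp: P0_def)
  finally show ?thesis by (simp add: mult_left_mono)
qed

text \<open>The weights \<open>1 / 2 ^ (j + 2)\<close> add up to 1/2. If each
  \<open>2 ^ (j + 2) * x j\<close> were below some \<open>c\<close> not exceeding the sum of the
  \<open>x j\<close>, that sum would be at most \<open>c / 2\<close>.\<close>

lemma suminf_power_le:
  fixes x :: "nat \<Rightarrow> ennreal"
  assumes "n \<ge> 1"
  shows "(\<Sum>j. x j) ^ n \<le> (\<Sum>j. (2 ^ (j + 2) * x j) ^ n)"
proof (rule ccontr)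
  assume "\<not> ?thesis"
  then have less: "(\<Sum>j. (2 ^ (j + 2) * x j) ^ n) < (\<Sum>j. x j) ^ n" by simp
  \<comment> \<open>A finite threshold is needed even when the left sum is infinite; then
    \<open>b + 1\<close> serves, with \<open>b\<close> the finite right-hand side, because
    \<open>b < (b + 1) ^ n\<close>.\<close>
  have "\<exists>c::real. c > 0 \<and> ennreal c \<le> (\<Sum>j. x j) \<and> (\<Sum>j. (2 ^ (j + 2) * x j) ^ n) < ennreal c ^ n"
  proof (cases "(\<Sum>j. x j)")
    case (real s)
    have "s \<noteq> 0" using less real assms by (cases "s = 0") (auto simp: power_0_left)
    then show ?thesis using less real by (intro exI[of _ s]) auto
  next
    case top
    with less obtain b where b: "(\<Sum>j. (2 ^ (j + 2) * x j) ^ n) = ennreal b" "b \<ge> 0"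
      using assms by (cases "(\<Sum>j. (2 ^ (j + 2) * x j) ^ n)") (auto simp: top_power_ennreal)
    have "b < (b + 1) ^ n" using b assms self_le_power[of "b + 1" n] by simp
    then have "ennreal b < ennreal (b + 1) ^ n"
      using b by (subst ennreal_power) (auto intro!: ennreal_lessI simp del: ennreal_plus)
    then show ?thesis using b top by (intro exI[of _ "b + 1"] conjI) (simp_all del: ennreal_plus)
  qed
  then obtain c :: real where c: "c > 0" "ennreal c \<le> (\<Sum>j. x j)" "(\<Sum>j. (2 ^ (j + 2) * x j) ^ n) < ennreal c ^ n"
    by blast
  have small: "2 ^ (j + 2) * x j < ennreal c" for j
  proof (rule ccontr)
    assume "\<not> ?thesis"
    then have "ennreal c ^ n \<le> (2 ^ (j + 2) * x j) ^ n" by (intro power_mono_ennreal) simp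
    also have "\<dots> \<le> (\<Sum>j. (2 ^ (j + 2) * x j) ^ n)"
      using sum_le_suminf[of "\<lambda>j. (2 ^ (j + 2) * x j) ^ n" "{j}"] by simp
    finally show False using c by simp
  qed
  have le: "x j \<le> ennreal (c / 4 * (1 / 2) ^ j)" for j
  proof -
    have "ennreal (1 / 2 ^ (j + 2)) * (2 ^ (j + 2) * x j) \<le> ennreal (1 / 2 ^ (j + 2)) * ennreal c"
      using small[of j] by (intro mult_left_mono) auto
    moreover have "ennreal (1 / 2 ^ (j + 2)) * 2 ^ (j + 2) = 1"
    proof -
      have "(2::ennreal) ^ (j + 2) = ennreal (2 ^ (j + 2))" by (subst ennreal_power[symmetric]) simp_all
      then show ?thesis by (simp flip: ennreal_mult)
    qed
    moreover have "ennreal (1 / 2 ^ (j + 2)) * ennreal c = ennreal (c / 4 * (1 / 2) ^ j)"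
      using c by (simp add: power_divide field_simps flip: ennreal_mult)
    ultimately show ?thesis by (simp flip: mult.assoc)
  qed
  have "(\<lambda>j. c / 4 * (1 / 2) ^ j) sums (c / 4 * (1 / (1 - 1/2)))"
    by (intro sums_mult geometric_sums) simp
  then have "(\<Sum>j. ennreal (c / 4 * (1 / 2) ^ j)) = ennreal (c / 2)"
    using c by (subst suminf_ennreal_eq[where x = "c / 2"]) auto
  moreover have "(\<Sum>j. x j) \<le> (\<Sum>j. ennreal (c / 4 * (1 / 2) ^ j))"
    using le by (intro suminf_le) auto
  ultimately have "ennreal c \<le> ennreal (c / 2)" using c by order
  then show False using c by (simp add: ennreal_le_iff)
qed

section \<open>Segment integrals of combined densities\<close>

lemma segment_integral_sum:
  fixes \<rho> :: "'b \<Rightarrow> 'a::euclidean_space \<Rightarrow> ennreal"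
  assumes "\<And>i. i \<in> I \<Longrightarrow> \<rho> i \<in> borel_measurable borel"
  shows "segment_integral (\<lambda>x. \<Sum>i\<in>I. \<rho> i x) p q = (\<Sum>i\<in>I. segment_integral (\<rho> i) p q)"
proof -
  have "(\<integral>\<^sup>+ t \<in> {0..1}. (\<Sum>i\<in>I. \<rho> i (p + t *\<^sub>R (q - p))) \<partial>lborel) =
      (\<Sum>i\<in>I. \<integral>\<^sup>+ t \<in> {0..1}. \<rho> i (p + t *\<^sub>R (q - p)) \<partial>lborel)"
    unfolding sum_distrib_right
    by (intro nn_integral_sum borel_measurable_times_ennreal) (auto intro!: measurable_affine_param assms)
  then show ?thesis by (simp add: segment_integral_def sum_distrib_left)
qed

lemma segment_integral_cmult:
  fixes \<rho> :: "'a::euclidean_space \<Rightarrow> ennreal"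
  assumes [measurable]: "\<rho> \<in> borel_measurable borel"
  shows "segment_integral (\<lambda>x. c * \<rho> x) p q = c * segment_integral \<rho> p q"
  by (simp add: segment_integral_def nn_integral_cmult mult.assoc mult.left_commute)

lemma segment_integral_suminf:
  fixes \<rho> :: "nat \<Rightarrow> 'a::euclidean_space \<Rightarrow> ennreal"
  assumes [measurable]: "\<And>i. \<rho> i \<in> borel_measurable borel"
  shows "segment_integral (\<lambda>x. \<Sum>i. \<rho> i x) p q = (\<Sum>i. segment_integral (\<rho> i) p q)"
proof -
  have "(\<integral>\<^sup>+ t \<in> {0..1}. (\<Sum>i. \<rho> i (p + t *\<^sub>R (q - p))) \<partial>lborel) =
      (\<integral>\<^sup>+ t. (\<Sum>i. \<rho> i (p + t *\<^sub>R (q - p)) * indicator {0..1} t) \<partial>lborel)"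
    by (simp add: ennreal_suminf_multc)
  also have "\<dots> = (\<Sum>i. \<integral>\<^sup>+ t \<in> {0..1}. \<rho> i (p + t *\<^sub>R (q - p)) \<partial>lborel)"
    by (intro nn_integral_suminf) measurable
  finally show ?thesis by (simp add: segment_integral_def)
qed

lemma emeasure_density_add_one:
  fixes Q :: "'a::euclidean_space \<Rightarrow> ennreal"
  assumes Q [measurable]: "Q \<in> borel_measurable lebesgue" and "S \<in> sets borel"
  shows "emeasure (density lebesgue (\<lambda>y. Q y + 1)) S = (\<integral>\<^sup>+ y \<in> S. Q y \<partial>lebesgue) + emeasure lborel S"
proof -
  have S [measurable]: "S \<in> sets lebesgue" using assms by simp
  have "emeasure (density lebesgue (\<lambda>y. Q y + 1)) S = (\<integral>\<^sup>+ y. Q y * indicator S y + indicator S y \<partial>lebesgue)"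
    by (subst emeasure_density) (auto simp: distrib_right)
  also have "\<dots> = (\<integral>\<^sup>+ y \<in> S. Q y \<partial>lebesgue) + (\<integral>\<^sup>+ y. indicator S y \<partial>lebesgue)"
    by (intro nn_integral_add) auto
  finally show ?thesis using assms by simp
qed

text \<open>
  The weight \<open>Q + 1\<close> makes the ring inequality strict, so that a density attains the bound. The set \<open>S\<close>
  stands in for an image under \<open>u \<circ> f\<close> that need not be measurable.
\<close>

lemma level_density:
  obtains N :: nat where "\<And>D (f :: 'a::euclidean_space \<Rightarrow> 'a) Q M \<delta> T W.
    open D \<Longrightarrow> continuous_on D f \<Longrightarrow> Q \<in> borel_measurable lebesgue \<Longrightarrow>
    M = density lebesgue (\<lambda>y. Q y + 1) \<Longrightarrow> \<delta> > 0 \<Longrightarrow> bounded T \<Longrightarrow>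
    W \<in> sets borel \<Longrightarrow> emeasure M W < \<infinity> \<Longrightarrow> (\<And>p. p \<in> T \<Longrightarrow> cball p (4 * \<delta>) \<subseteq> W) \<Longrightarrow>
    (\<And>p. p \<in> T \<Longrightarrow> modulus (lifted_paths D f p (2 * \<delta>) (4 * \<delta>)) \<le>
       ennreal (1 / (2 * \<delta>)) ^ DIM('a) * (\<integral>\<^sup>+ y \<in> cball p (4 * \<delta>). Q y \<partial>lebesgue)) \<Longrightarrow>
    \<exists>\<rho> \<in> borel_measurable borel.
      (\<integral>\<^sup>+ x. \<rho> x ^ DIM('a) \<partial>lborel) \<le> of_nat N * emeasure M W \<and>
      (\<forall>x y u. closed_segment x y \<subseteq> D \<longrightarrow> (\<forall>v w. \<bar>u v - u w\<bar> \<le> dist v w) \<longrightarrow> 8 * \<delta> < \<bar>u (f x) - u (f y)\<bar> \<longrightarrow>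
        (\<exists>S\<in>sets lborel. (\<forall>s\<in>closed_segment x y. (\<exists>p\<in>T. dist (f s) p < \<delta>) \<longrightarrow> u (f s) \<in> S) \<and>
           emeasure lborel (S :: real set) \<le> segment_integral \<rho> x y))"
proof -
  define n where "n = DIM('a)"
  have n: "n \<ge> 1" by (simp add: n_def Suc_le_eq)
  obtain N :: nat where "N > 0" and N: "\<And>\<delta> (z :: 'a) P. \<delta> > 0 \<Longrightarrow> P \<subseteq> cball z (4 * \<delta>) \<Longrightarrow>
     (\<And>p q. p \<in> P \<Longrightarrow> q \<in> P \<Longrightarrow> p \<noteq> q \<Longrightarrow> \<delta> \<le> dist p q) \<Longrightarrow> finite P \<and> card P \<le> N"
    using separated_card_bound[of 4] by blast
  show thesis
  \<comment> \<open>\<open>N ^ n\<close> comes from taking the power of a sum with at most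
    \<open>N\<close> nonzero terms, \<open>2 ^ n\<close> from weight over ring width,
    \<open>4 * \<delta> / (2 * \<delta>)\<close>, and the last \<open>N\<close> from the overlap of
    the balls in \<open>W\<close>.\<close>
  proof (rule that[of "N ^ n * 2 ^ n * N"])
    fix D and f :: "'a \<Rightarrow> 'a" and Q :: "'a \<Rightarrow> ennreal" and M \<delta> T W
    assume D: "open D" and f: "continuous_on D f" and [measurable]: "Q \<in> borel_measurable lebesgue"
      and M: "M = density lebesgue (\<lambda>y. Q y + 1)" and "\<delta> > (0::real)" and "bounded T"
      and W: "W \<in> sets borel" "emeasure M W < \<infinity>" and TW: "\<And>p. p \<in> T \<Longrightarrow> cball p (4 * \<delta>) \<subseteq> W"
      and modT: "\<And>p. p \<in> T \<Longrightarrow> modulus (lifted_paths D f p (2 * \<delta>) (4 * \<delta>)) \<le>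
       ennreal (1 / (2 * \<delta>)) ^ DIM('a) * (\<integral>\<^sup>+ y \<in> cball p (4 * \<delta>). Q y \<partial>lebesgue)"
    have setsM: "S \<in> sets M" if "S \<in> sets borel" for S
      using that M by simp
    note M_eq = emeasure_density_add_one[OF \<open>Q \<in> borel_measurable lebesgue\<close>, folded M]
    obtain P where P: "finite P" "P \<subseteq> T" and sep: "\<And>p q. p \<in> P \<Longrightarrow> q \<in> P \<Longrightarrow> p \<noteq> q \<Longrightarrow> \<delta> \<le> dist p q"
      and cov: "\<And>x. x \<in> T \<Longrightarrow> \<exists>p\<in>P. dist x p < \<delta>"
      using maximal_separated_subset[OF \<open>bounded T\<close> \<open>\<delta> > 0\<close>] by metis
    define ok where "ok p \<rho> \<longleftrightarrow> \<rho> \<in> borel_measurable borel \<and>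
        (\<integral>\<^sup>+ x. \<rho> x ^ n \<partial>lborel) \<le> ennreal (1 / (2 * \<delta>)) ^ n * emeasure M (cball p (4 * \<delta>)) \<and>
        (\<forall>x. \<rho> x \<noteq> 0 \<longrightarrow> dist (f x) p \<le> 4 * \<delta>) \<and>
        (\<forall>x y s s'. closed_segment x y \<subseteq> D \<longrightarrow> s \<in> closed_segment x y \<longrightarrow> s' \<in> closed_segment x y \<longrightarrow>
           dist (f s) p \<le> 2 * \<delta> \<longrightarrow> 4 * \<delta> \<le> dist (f s') p \<longrightarrow> 1 \<le> segment_integral \<rho> x y)" for p \<rho>
    have "\<exists>\<rho>. ok p \<rho>"
      if "p \<in> P" for p
    proof -
      have "p \<in> T" using that P by blast
      have "emeasure M (cball p (4 * \<delta>)) \<le> emeasure M W"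
        using TW[OF \<open>p \<in> T\<close>] W by (intro emeasure_mono setsM)
      then have "(\<integral>\<^sup>+ y \<in> cball p (4 * \<delta>). Q y \<partial>lebesgue) \<noteq> \<infinity>"
        using W(2) M_eq[of "cball p (4 * \<delta>)"] by auto
      moreover have "emeasure lborel (cball p (4 * \<delta>)) > 0"
        using \<open>\<delta> > 0\<close> by (simp add: emeasure_cball)
      ultimately have "(\<integral>\<^sup>+ y \<in> cball p (4 * \<delta>). Q y \<partial>lebesgue) + 0 < emeasure M (cball p (4 * \<delta>))"
        by (subst M_eq) (auto simp: ennreal_add_left_cancel_less)
      then have "ennreal (1 / (2 * \<delta>)) ^ n * (\<integral>\<^sup>+ y \<in> cball p (4 * \<delta>). Q y \<partial>lebesgue) <
          ennreal (1 / (2 * \<delta>)) ^ n * emeasure M (cball p (4 * \<delta>))"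
        using \<open>\<delta> > 0\<close> by (intro ennreal_mult_strict_left_mono) (simp_all add: ennreal_power)
      with modT[OF \<open>p \<in> T\<close>] have M_less: "modulus (lifted_paths D f p (2 * \<delta>) (4 * \<delta>)) < ennreal (1 / (2 * \<delta>)) ^ n * emeasure M (cball p (4 * \<delta>))"
        by (simp add: n_def)
      have "2 * \<delta> < 4 * \<delta>" using \<open>\<delta> > 0\<close> by simp
      then show ?thesis
      proof (rule ring_density[OF D f _ M_less])
        fix \<rho> :: "'a \<Rightarrow> ennreal"
        assume \<rho>: "\<rho> \<in> borel_measurable borel"
            "(\<integral>\<^sup>+ x. \<rho> x ^ DIM('a) \<partial>lborel) \<le> ennreal (1 / (2 * \<delta>)) ^ n * emeasure M (cball p (4 * \<delta>))"
            "\<And>x. \<rho> x \<noteq> 0 \<Longrightarrow> dist (f x) p \<le> 4 * \<delta>"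
          and "\<And>x y s s'. closed_segment x y \<subseteq> D \<Longrightarrow> s \<in> closed_segment x y \<Longrightarrow> s' \<in> closed_segment x y \<Longrightarrow>
            dist (f s) p \<le> 2 * \<delta> \<Longrightarrow> 4 * \<delta> \<le> dist (f s') p \<Longrightarrow> 1 \<le> segment_integral \<rho> x y"
        then have "\<forall>x y s s'. closed_segment x y \<subseteq> D \<longrightarrow> s \<in> closed_segment x y \<longrightarrow> s' \<in> closed_segment x y \<longrightarrow>
            dist (f s) p \<le> 2 * \<delta> \<longrightarrow> 4 * \<delta> \<le> dist (f s') p \<longrightarrow> 1 \<le> segment_integral \<rho> x y"
          by metis
        with \<rho> show "\<exists>\<rho>. ok p \<rho>"
          unfolding ok_def n_def by (intro exI[of _ \<rho>] conjI) simp_all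
      qed
    qed
    then obtain \<rho> where ok: "\<And>p. p \<in> P \<Longrightarrow> ok p (\<rho> p)" by metis
    have \<rho>: "\<rho> p \<in> borel_measurable borel"
      and energy: "(\<integral>\<^sup>+ x. \<rho> p x ^ n \<partial>lborel) \<le> ennreal (1 / (2 * \<delta>)) ^ n * emeasure M (cball p (4 * \<delta>))"
      and supp: "\<And>x. \<rho> p x \<noteq> 0 \<Longrightarrow> dist (f x) p \<le> 4 * \<delta>"
      and adm: "\<And>x y s s'. closed_segment x y \<subseteq> D \<Longrightarrow> s \<in> closed_segment x y \<Longrightarrow> s' \<in> closed_segment x y \<Longrightarrow>
           dist (f s) p \<le> 2 * \<delta> \<Longrightarrow> 4 * \<delta> \<le> dist (f s') p \<Longrightarrow> 1 \<le> segment_integral (\<rho> p) x y"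
      if "p \<in> P" for p
      using ok[OF that] unfolding ok_def by blast+
    have near: "card {p \<in> P. dist y p \<le> 4 * \<delta>} \<le> N" for y
    proof -
      have "{p \<in> P. dist y p \<le> 4 * \<delta>} \<subseteq> cball y (4 * \<delta>)" by auto
      from N[OF \<open>\<delta> > 0\<close> this] show ?thesis using sep by blast
    qed
    \<comment> \<open>The weight \<open>4 * \<delta>\<close> is the length of the interval of values
      that each centre contributes to the set \<open>S\<close> below.\<close>
    define \<sigma> where "\<sigma> x = (\<Sum>p\<in>P. ennreal (4 * \<delta>) * \<rho> p x)" for x
    have \<sigma>: "\<sigma> \<in> borel_measurable borel"
      unfolding \<sigma>_def using \<rho> by (intro borel_measurable_sum borel_measurable_times_ennreal) auto
    show "\<exists>\<rho>\<in>borel_measurable borel.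
      (\<integral>\<^sup>+ x. \<rho> x ^ DIM('a) \<partial>lborel) \<le> of_nat (N ^ n * 2 ^ n * N) * emeasure M W \<and>
      (\<forall>x y u. closed_segment x y \<subseteq> D \<longrightarrow> (\<forall>v w. \<bar>u v - u w\<bar> \<le> dist v w) \<longrightarrow> 8 * \<delta> < \<bar>u (f x) - u (f y)\<bar> \<longrightarrow>
        (\<exists>S\<in>sets lborel. (\<forall>s\<in>closed_segment x y. (\<exists>p\<in>T. dist (f s) p < \<delta>) \<longrightarrow> u (f s) \<in> S) \<and>
           emeasure lborel (S :: real set) \<le> segment_integral \<rho> x y))"
    proof (intro bexI[of _ \<sigma>] conjI allI impI \<sigma>)
      have "(\<integral>\<^sup>+ x. \<sigma> x ^ DIM('a) \<partial>lborel) \<le>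
          (\<integral>\<^sup>+ x. of_nat N ^ n * (\<Sum>p\<in>P. (ennreal (4 * \<delta>) * \<rho> p x) ^ n) \<partial>lborel)"
      proof (intro nn_integral_mono)
        fix x
        have "card {p \<in> P. ennreal (4 * \<delta>) * \<rho> p x \<noteq> 0} \<le> card {p \<in> P. dist (f x) p \<le> 4 * \<delta>}"
          using P(1) supp by (intro card_mono) auto
        also note near
        finally show "\<sigma> x ^ DIM('a) \<le> of_nat N ^ n * (\<Sum>p\<in>P. (ennreal (4 * \<delta>) * \<rho> p x) ^ n)"
          unfolding \<sigma>_def n_def[symmetric] using P(1) n by (intro sum_power_le_card_power)
      qed
      also have "\<dots> = of_nat N ^ n * (\<Sum>p\<in>P. ennreal (4 * \<delta>) ^ n * (\<integral>\<^sup>+ x. \<rho> p x ^ n \<partial>lborel))"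
        using \<rho> by (subst nn_integral_cmult) (auto simp: power_mult_distrib nn_integral_sum nn_integral_cmult intro!: sum.cong)
      also have "\<dots> \<le> of_nat N ^ n * (\<Sum>p\<in>P. ennreal (4 * \<delta>) ^ n * (ennreal (1 / (2 * \<delta>)) ^ n * emeasure M (cball p (4 * \<delta>))))"
        by (intro mult_left_mono sum_mono energy) auto
      also have "(\<Sum>p\<in>P. ennreal (4 * \<delta>) ^ n * (ennreal (1 / (2 * \<delta>)) ^ n * emeasure M (cball p (4 * \<delta>)))) =
          2 ^ n * (\<Sum>p\<in>P. emeasure M (cball p (4 * \<delta>)))"
      proof -
        have "ennreal (4 * \<delta>) * ennreal (1 / (2 * \<delta>)) = 2"
          using \<open>\<delta> > 0\<close> by (simp flip: ennreal_mult)
        then have "ennreal (4 * \<delta>) ^ n * ennreal (1 / (2 * \<delta>)) ^ n = 2 ^ n"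
          by (simp flip: power_mult_distrib)
        then show ?thesis by (simp add: sum_distrib_left flip: mult.assoc)
      qed
      also have "(\<Sum>p\<in>P. emeasure M (cball p (4 * \<delta>))) \<le> of_nat N * emeasure M W"
      proof -
        have "(\<Sum>p\<in>P. emeasure M (cball p (4 * \<delta>))) = (\<Sum>p\<in>P. \<integral>\<^sup>+ y. indicator (cball p (4 * \<delta>)) y \<partial>M)"
          by (intro sum.cong refl nn_integral_indicator[symmetric] setsM) auto
        also have "\<dots> = (\<integral>\<^sup>+ y. (\<Sum>p\<in>P. indicator (cball p (4 * \<delta>)) y) \<partial>M)"
          by (intro nn_integral_sum[symmetric] borel_measurable_indicator setsM) auto
        also have "\<dots> \<le> (\<integral>\<^sup>+ y. of_nat N * indicator W y \<partial>M)"
        proof (intro nn_integral_mono)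
          fix y
          have "(\<Sum>p\<in>P. indicator (cball p (4 * \<delta>)) y :: ennreal) = (\<Sum>p\<in>{p \<in> P. dist y p \<le> 4 * \<delta>}. 1)"
            using P(1) by (intro sum.mono_neutral_cong_right) (auto simp: indicator_def dist_commute)
          also have "\<dots> = of_nat (card {p \<in> P. dist y p \<le> 4 * \<delta>})" by simp
          finally have eq: "(\<Sum>p\<in>P. indicator (cball p (4 * \<delta>)) y :: ennreal) = \<dots>" .
          show "(\<Sum>p\<in>P. indicator (cball p (4 * \<delta>)) y) \<le> of_nat N * (indicator W y :: ennreal)"
          proof (cases "y \<in> W")
            case True
            then show ?thesis using near[of y] unfolding eq by simp
          next
            case False
            then have none: "{p \<in> P. dist y p \<le> 4 * \<delta>} = {}" using TW P(2) by (force simp: dist_commute)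
            show ?thesis unfolding eq none by simp
          qed
        qed
        also have "\<dots> = of_nat N * emeasure M W"
          by (intro nn_integral_cmult_indicator setsM W)
        finally show ?thesis .
      qed
      finally show "(\<integral>\<^sup>+ x. \<sigma> x ^ DIM('a) \<partial>lborel) \<le> of_nat (N ^ n * 2 ^ n * N) * emeasure M W"
        by (simp add: mult_left_mono mult.assoc)
    next
      fix x y and u :: "'a \<Rightarrow> real"
      assume seg: "closed_segment x y \<subseteq> D" and lip: "\<forall>v w. \<bar>u v - u w\<bar> \<le> dist v w"
        and big: "8 * \<delta> < \<bar>u (f x) - u (f y)\<bar>"
      \<comment> \<open>The centres whose inner ball meets the image of the segment; the intervals
        of radius \<open>2 * \<delta>\<close> about their values under \<open>u\<close> make up
        \<open>S\<close>.\<close>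
      define H where "H = {p \<in> P. \<exists>s\<in>closed_segment x y. dist (f s) p \<le> 2 * \<delta>}"
      have H: "finite H" "H \<subseteq> P" using P by (auto simp: H_def)
      define S where "S = (\<Union>p\<in>H. {u p - 2 * \<delta>..u p + 2 * \<delta>})"
      show "\<exists>S\<in>sets lborel. (\<forall>s\<in>closed_segment x y. (\<exists>p\<in>T. dist (f s) p < \<delta>) \<longrightarrow> u (f s) \<in> S) \<and>
           emeasure lborel S \<le> segment_integral \<sigma> x y"
      proof (intro bexI[of _ S] conjI ballI impI)
        show "S \<in> sets lborel" using H by (auto simp: S_def)
        show "u (f s) \<in> S" if s: "s \<in> closed_segment x y" and ex: "\<exists>p\<in>T. dist (f s) p < \<delta>" for s
        proof -
          obtain q where "q \<in> T" "dist (f s) q < \<delta>" using ex by blast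
          then obtain p where p: "p \<in> P" "dist q p < \<delta>" using cov by blast
          have "dist (f s) p < 2 * \<delta>"
            using dist_triangle[of "f s" p q] \<open>dist (f s) q < \<delta>\<close> p by simp
          moreover from this have "p \<in> H" using p s by (force simp: H_def)
          moreover have "\<bar>u (f s) - u p\<bar> \<le> dist (f s) p" using lip by blast
          ultimately show ?thesis unfolding S_def by (intro UN_I[of p]) auto
        qed
        have "emeasure lborel S \<le> (\<Sum>p\<in>H. emeasure lborel {u p - 2 * \<delta>..u p + 2 * \<delta>})"
          unfolding S_def using H by (intro emeasure_subadditive_finite) auto
        also have "\<dots> = (\<Sum>p\<in>H. ennreal (4 * \<delta>) * 1)"
          using \<open>\<delta> > 0\<close> by simp
        also have "\<dots> \<le> (\<Sum>p\<in>H. ennreal (4 * \<delta>) * segment_integral (\<rho> p) x y)"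
        proof (intro sum_mono mult_left_mono)
          fix p assume "p \<in> H"
          then obtain s where s: "p \<in> P" "s \<in> closed_segment x y" "dist (f s) p \<le> 2 * \<delta>" by (auto simp: H_def)
          \<comment> \<open>The image of the segment cannot stay within distance
            \<open>4 * \<delta>\<close> of \<open>p\<close>: its ends would be less than
            \<open>8 * \<delta>\<close> apart, against \<open>big\<close> for the 1-Lipschitz
            \<open>u\<close>. So the ring about \<open>p\<close> is fully crossed.\<close>
          have "\<exists>s'\<in>closed_segment x y. 4 * \<delta> \<le> dist (f s') p"
          proof (rule ccontr)
            assume "\<not> ?thesis"
            then have "dist (f x) p < 4 * \<delta>" "dist (f y) p < 4 * \<delta>"
              by (force simp: not_le)+
            moreover have "dist (f x) (f y) \<le> dist (f x) p + dist (f y) p" by (rule dist_triangle2)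
            moreover have "\<bar>u (f x) - u (f y)\<bar> \<le> dist (f x) (f y)" using lip by blast
            ultimately show False using big by linarith
          qed
          then show "1 \<le> segment_integral (\<rho> p) x y" using adm[OF s(1) seg s(2) _ s(3)] by blast
        qed auto
        also have "\<dots> \<le> (\<Sum>p\<in>P. ennreal (4 * \<delta>) * segment_integral (\<rho> p) x y)"
          using P H by (intro sum_mono2) auto
        also have "\<dots> = segment_integral \<sigma> x y"
          unfolding \<sigma>_def using \<rho>
          by (subst segment_integral_sum) (auto simp: segment_integral_cmult intro!: sum.cong)
        finally show "emeasure lborel S \<le> segment_integral \<sigma> x y" .
      qed
    qed
  qed
qed

lemma ennreal_suminf_le_double:
  fixes b :: "nat \<Rightarrow> ennreal"
  assumes "c \<ge> 0" "\<And>j. b j \<le> ennreal (c * (1 / 2) ^ j)"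
  shows "(\<Sum>j. b j) \<le> ennreal (2 * c)"
proof -
  have "(\<lambda>j. c * (1 / 2) ^ j) sums (c * (1 / (1 - 1/2)))"
    by (intro sums_mult geometric_sums) simp
  then have "(\<Sum>j. ennreal (c * (1 / 2) ^ j)) = ennreal (2 * c)"
    using assms by (subst suminf_ennreal_eq[where x = "2 * c"]) (auto simp: mult.commute)
  moreover have "(\<Sum>j. b j) \<le> (\<Sum>j. ennreal (c * (1 / 2) ^ j))"
    using assms by (intro suminf_le) auto
  ultimately show ?thesis by simp
qed

text \<open>The bound \<open>C\<close> is fixed before \<open>f\<close> and
  \<open>\<epsilon>\<close>; \<open>\<epsilon>\<close> only limits the size of the rings. At each
  level the segment integral pays for the values of \<open>u\<close> near that level's centres, and
  together the levels cover every value between those at the ends. The condition on \<open>z\<close>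
  confines the relevant part of the image to a ball, where the mass is finite.\<close>

lemma energy_bound:
  fixes Q :: "'a::euclidean_space \<Rightarrow> ennreal" and D :: "'a set"
  assumes D: "open D" and Q: "locally_integrable Q"
  obtains C :: real where "\<And>f \<epsilon>. continuous_on D f \<Longrightarrow> (\<And>y. inverse_Poletsky D Q f y) \<Longrightarrow> \<epsilon> > 0 \<Longrightarrow>
    \<exists>\<rho>\<in>borel_measurable borel. (\<integral>\<^sup>+ x. \<rho> x ^ DIM('a) \<partial>lborel) \<le> ennreal C \<and>
      (\<forall>x y u. closed_segment x y \<subseteq> D \<longrightarrow> (\<forall>v w. \<bar>u v - u w\<bar> \<le> dist v w) \<longrightarrow>
        (\<forall>z. min (u (f x)) (u (f y)) < u z \<longrightarrow> u z < max (u (f x)) (u (f y)) \<longrightarrow> z \<in> cball a R) \<longrightarrow>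
        \<epsilon> \<le> \<bar>u (f x) - u (f y)\<bar> \<longrightarrow> ennreal \<bar>u (f x) - u (f y)\<bar> \<le> segment_integral \<rho> x y)"
proof -
  define n where "n = DIM('a)"
  have n: "n \<ge> 1" by (simp add: n_def Suc_le_eq)
  have Qm: "Q \<in> borel_measurable lebesgue" using Q by (simp add: locally_integrable_def)
  define M where "M = density lebesgue (\<lambda>y. Q y + 1)"
  \<comment> \<open>The extra 1 leaves room for the rings: their points lie within
    \<open>5 * \<delta> j \<le> 1\<close> of \<open>cball a R\<close>.\<close>
  define X where "X = cball a (R + 1)"
  have setsM: "S \<in> sets M" if "S \<in> sets borel" for S using that by (simp add: M_def)
  have X_borel: "X \<in> sets borel" by (simp add: X_def)
  have "(\<integral>\<^sup>+ y \<in> X. Q y \<partial>lebesgue) < \<infinity>" using Q by (simp add: locally_integrable_def X_def)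
  then have X: "emeasure M X < \<infinity>"
    unfolding M_def using emeasure_density_add_one[OF Qm X_borel] emeasure_compact_finite[of X]
    by (simp add: X_def less_top[symmetric])
  define m where "m = enn2real (emeasure M X)"
  have m: "m \<ge> 0" "emeasure M X = ennreal m" using X by (auto simp: m_def)
  show thesis
  proof (rule level_density[where 'a = 'a])
    fix N :: nat
    assume level: "\<And>D (f :: 'a \<Rightarrow> 'a) Q M \<delta> T W.
    open D \<Longrightarrow> continuous_on D f \<Longrightarrow> Q \<in> borel_measurable lebesgue \<Longrightarrow>
    M = density lebesgue (\<lambda>y. Q y + 1) \<Longrightarrow> \<delta> > 0 \<Longrightarrow> bounded T \<Longrightarrow>
    W \<in> sets borel \<Longrightarrow> emeasure M W < \<infinity> \<Longrightarrow> (\<And>p. p \<in> T \<Longrightarrow> cball p (4 * \<delta>) \<subseteq> W) \<Longrightarrow>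
    (\<And>p. p \<in> T \<Longrightarrow> modulus (lifted_paths D f p (2 * \<delta>) (4 * \<delta>)) \<le>
       ennreal (1 / (2 * \<delta>)) ^ DIM('a) * (\<integral>\<^sup>+ y \<in> cball p (4 * \<delta>). Q y \<partial>lebesgue)) \<Longrightarrow>
    \<exists>\<rho> \<in> borel_measurable borel.
      (\<integral>\<^sup>+ x. \<rho> x ^ DIM('a) \<partial>lborel) \<le> of_nat N * emeasure M W \<and>
      (\<forall>x y u. closed_segment x y \<subseteq> D \<longrightarrow> (\<forall>v w. \<bar>u v - u w\<bar> \<le> dist v w) \<longrightarrow> 8 * \<delta> < \<bar>u (f x) - u (f y)\<bar> \<longrightarrow>
        (\<exists>S\<in>sets lborel. (\<forall>s\<in>closed_segment x y. (\<exists>p\<in>T. dist (f s) p < \<delta>) \<longrightarrow> u (f s) \<in> S) \<and>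
           emeasure lborel (S :: real set) \<le> segment_integral \<rho> x y))"
    \<comment> \<open>\<open>4 ^ n * m\<close> pays for level 0, which carries the weight
      \<open>2 ^ 2\<close>, and the 1 for the later levels; the geometric sum then doubles
      \<open>c\<close>.\<close>
    define c where "c = real N * (4 ^ n * m + 1)"
    have "c \<ge> 0" using m by (simp add: c_def)
    show thesis
    proof (rule that[of "2 * c"])
      fix f :: "'a \<Rightarrow> 'a" and \<epsilon> :: real
      assume f: "continuous_on D f" and P: "\<And>y. inverse_Poletsky D Q f y" and "\<epsilon> > 0"
      have "\<exists>r0>0. \<forall>r1 r2. 0 < r1 \<longrightarrow> r1 < r2 \<longrightarrow> r2 < r0 \<longrightarrow> modulus (lifted_paths D f y r1 r2) \<le>
          ennreal (1 / (r2 - r1)) ^ DIM('a) * (\<integral>\<^sup>+ y \<in> cball y r2. Q y \<partial>lebesgue)" for y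
        by (rule poletsky_ring_modulus[OF P[of y] Qm]) blast
      then obtain r0 where r0: "\<And>y. r0 y > 0"
        and ring: "\<And>y r1 r2. 0 < r1 \<Longrightarrow> r1 < r2 \<Longrightarrow> r2 < r0 y \<Longrightarrow> modulus (lifted_paths D f y r1 r2) \<le>
          ennreal (1 / (r2 - r1)) ^ DIM('a) * (\<integral>\<^sup>+ y \<in> cball y r2. Q y \<partial>lebesgue)"
        by metis
      define A where "A k = {y. 1 / (real k + 1) < r0 y}" for k :: nat
      have A_mono: "A k \<subseteq> A k'" if "k \<le> k'" for k k'
      proof -
        have "1 / (real k' + 1) \<le> 1 / (real k + 1)" using that by (simp add: field_simps)
        then show ?thesis by (auto simp: A_def)
      qed
      have A_ex: "\<exists>k. y \<in> A k" for y
        using reals_Archimedean[OF r0[of y]] by (auto simp: A_def inverse_eq_divide add.commute)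
      \<comment> \<open>The denominator cancels the weight \<open>2 ^ (j + 3)\<close> that
        \<open>suminf_power_le\<close> puts on the next level \<open>Suc j\<close>, leaving a
        geometric decay.\<close>
      define e where "e j = (1/2 :: real) ^ Suc j / (2 ^ (j + 3)) ^ n" for j :: nat
      have e: "e j > 0" for j by (simp add: e_def)
      \<comment> \<open>The radii \<open>r0\<close> come from a choice, so \<open>A k\<close> need
        not be measurable; its closure is.\<close>
      have "(\<lambda>k. emeasure M (X - closure (A k))) \<longlonglongrightarrow> emeasure M (\<Inter>k. X - closure (A k))"
      proof (rule Lim_emeasure_decseq)
        show "range (\<lambda>k. X - closure (A k)) \<subseteq> sets M" using X_borel by (auto intro!: setsM)
        show "decseq (\<lambda>k. X - closure (A k))"
          using A_mono closure_mono unfolding decseq_def by blast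
        show "emeasure M (X - closure (A k)) \<noteq> \<infinity>" for k
        proof -
          have "emeasure M (X - closure (A k)) \<le> emeasure M X"
            by (intro emeasure_mono setsM X_borel) auto
          with X show ?thesis by auto
        qed
      qed
      also have "(\<Inter>k. X - closure (A k)) = {}"
      proof -
        have "\<exists>k. y \<in> closure (A k)" for y
          using A_ex[of y] closure_subset by blast
        then show ?thesis by auto
      qed
      finally have lim: "(\<lambda>k. emeasure M (X - closure (A k))) \<longlonglongrightarrow> 0" by simp
      have "\<exists>k\<ge>j. emeasure M (X - closure (A k)) < ennreal (e j)" for j
      proof -
        have "eventually (\<lambda>k. emeasure M (X - closure (A k)) < ennreal (e j)) sequentially"
          by (rule order_tendstoD(2)[OF lim]) (use e in simp)
        then have "eventually (\<lambda>k. k \<ge> j \<and> emeasure M (X - closure (A k)) < ennreal (e j)) sequentially"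
          by (intro eventually_conj eventually_ge_at_top)
        then show ?thesis by (auto dest: eventually_happens)
      qed
      then obtain k where k: "\<And>j. j \<le> k j" "\<And>j. emeasure M (X - closure (A (k j))) < ennreal (e j)"
        by metis
      define F where "F j = A (k j)" for j
      have F_ex: "\<exists>j. y \<in> F j" for y
        using A_ex[of y] A_mono k(1) unfolding F_def by blast
      \<comment> \<open>The product shrinks the scale at least by the factor 6 from level to level
        and keeps \<open>4 * \<delta> j\<close> below \<open>1 / (real (k j) + 1)\<close>, hence
        below \<open>r0\<close> on \<open>F j\<close>. The factor in front gives
        \<open>8 * \<delta> j < \<epsilon>\<close>.\<close>
      define \<delta> where "\<delta> j = min \<epsilon> 1 / 10 * (\<Prod>i\<le>j. 1 / (6 * (real (k i) + 1)))" for j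
      have \<delta>pos: "\<delta> j > 0" for j unfolding \<delta>_def using \<open>\<epsilon> > 0\<close> by (intro mult_pos_pos prod_pos) auto
      have le6: "1 / (6 * (real i + 1)) \<le> 1/6" for i by (simp add: field_simps)
      have \<delta>_le: "\<delta> j \<le> min \<epsilon> 1 / 10 * (1 / (6 * (real (k j) + 1)))" for j
      proof -
        have "(\<Prod>i\<le>j. 1 / (6 * (real (k i) + 1))) = 1 / (6 * (real (k j) + 1)) * (\<Prod>i<j. 1 / (6 * (real (k i) + 1)))"
          by (simp add: lessThan_Suc_atMost[symmetric] mult.commute)
        also have "(\<Prod>i<j. 1 / (6 * (real (k i) + 1))) \<le> 1"
          using le6 by (intro prod_le_1) (auto intro: order_trans)
        finally have "(\<Prod>i\<le>j. 1 / (6 * (real (k i) + 1))) \<le> 1 / (6 * (real (k j) + 1)) * 1"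
          by (simp add: mult_left_mono divide_right_mono)
        then show ?thesis unfolding \<delta>_def using \<open>\<epsilon> > 0\<close> by (intro mult_left_mono) auto
      qed
      have \<delta>_r0: "4 * \<delta> j < 1 / (real (k j) + 1)" for j
      proof -
        define h where "h = 1 / (real (k j) + 1)"
        have "h > 0" by (simp add: h_def)
        note \<delta>_le[of j]
        also have "min \<epsilon> 1 / 10 * (1 / (6 * (real (k j) + 1))) \<le> 1 / 10 * (1 / (6 * (real (k j) + 1)))"
          by (intro mult_right_mono) auto
        also have "\<dots> = h / 60" by (simp add: h_def)
        finally show ?thesis using \<open>h > 0\<close> unfolding h_def[symmetric] by linarith
      qed
      have \<delta>60: "\<delta> j \<le> min \<epsilon> 1 / 60" for j
      proof -
        note \<delta>_le[of j]
        also have "min \<epsilon> 1 / 10 * (1 / (6 * (real (k j) + 1))) \<le> min \<epsilon> 1 / 10 * (1 / 6)"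
          using \<open>\<epsilon> > 0\<close> le6 by (intro mult_left_mono) auto
        also have "\<dots> = min \<epsilon> 1 / 60" by simp
        finally show ?thesis .
      qed
      have \<delta>_Suc: "\<delta> (Suc j) \<le> \<delta> j / 6" for j
      proof -
        have "\<delta> (Suc j) = \<delta> j * (1 / (6 * (real (k (Suc j)) + 1)))"
          by (simp add: \<delta>_def)
        also have "\<dots> \<le> \<delta> j * (1 / 6)"
          using \<delta>pos[of j] le6 by (intro mult_left_mono) auto
        finally show ?thesis by simp
      qed
      \<comment> \<open>Centres in \<open>F j\<close> near a point that stays at distance at least
        \<open>\<delta> i\<close> from every earlier \<open>F i\<close>; this margin keeps their
        rings off the closure of the preceding one.\<close>
      define T where "T j = {p \<in> F j. \<exists>y\<in>cball a R. dist y p < \<delta> j \<and> (\<forall>i<j. \<forall>q\<in>F i. \<delta> i \<le> dist y q)}" for j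
      \<comment> \<open>Level \<open>Suc i\<close> leaves out the closure of \<open>F i\<close>, so
        its mass is below \<open>e i\<close>; level 0 uses all of \<open>X\<close>.\<close>
      define W where "W j = (case j of 0 \<Rightarrow> X | Suc i \<Rightarrow> X - closure (F i))" for j
      have W_borel: "W j \<in> sets borel" for j
        using X_borel by (auto simp: W_def split: nat.split)
      have W_le: "(2 ^ (j + 2)) ^ n * (of_nat N * emeasure M (W j)) \<le> ennreal (c * (1 / 2) ^ j)" for j
      proof (cases j)
        case 0
        have "(2 ^ (j + 2)) ^ n * (of_nat N * emeasure M (W j)) = ennreal (4 ^ n * (real N * m))"
          using m by (simp add: 0 W_def ennreal_mult ennreal_of_nat_eq_real_of_nat flip: ennreal_power)
        also have "\<dots> \<le> ennreal (c * (1 / 2) ^ j)"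
          by (intro ennreal_leI) (simp add: 0 c_def algebra_simps)
        finally show ?thesis .
      next
        case (Suc i)
        have "(2 ^ (j + 2)) ^ n * (of_nat N * emeasure M (W j)) \<le> ennreal ((2 ^ (i + 3)) ^ n) * (ennreal (real N) * ennreal (e i))"
        proof (intro mult_mono)
          have "ennreal ((2 ^ (i + 3)) ^ n) = (ennreal 2 ^ (i + 3)) ^ n"
            by (subst ennreal_power, simp, subst ennreal_power) simp_all
          then show "(2 ^ (j + 2)) ^ n \<le> ennreal ((2 ^ (i + 3)) ^ n)"
            by (simp add: Suc numeral_3_eq_3)
          show "emeasure M (W j) \<le> ennreal (e i)"
            using k(2)[of i] by (simp add: Suc W_def F_def less_imp_le)
        qed (simp_all add: ennreal_of_nat_eq_real_of_nat)
        also have "\<dots> = ennreal ((2 ^ (i + 3)) ^ n * (real N * e i))"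
          using e[of i] by (simp add: ennreal_mult less_imp_le)
        also have "(2 ^ (i + 3)) ^ n * (real N * e i) = real N * (1/2) ^ j"
          by (simp add: e_def Suc)
        also have "ennreal (real N * (1/2) ^ j) \<le> ennreal (c * (1 / 2) ^ j)"
          using m unfolding c_def by (intro ennreal_leI mult_right_mono) (auto simp: distrib_left)
        finally show ?thesis .
      qed
      have "\<exists>\<rho>\<in>borel_measurable borel.
        (\<integral>\<^sup>+ x. \<rho> x ^ DIM('a) \<partial>lborel) \<le> of_nat N * emeasure M (W j) \<and>
        (\<forall>x y u. closed_segment x y \<subseteq> D \<longrightarrow> (\<forall>v w. \<bar>u v - u w\<bar> \<le> dist v w) \<longrightarrow> 8 * \<delta> j < \<bar>u (f x) - u (f y)\<bar> \<longrightarrow>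
          (\<exists>S\<in>sets lborel. (\<forall>s\<in>closed_segment x y. (\<exists>p\<in>T j. dist (f s) p < \<delta> j) \<longrightarrow> u (f s) \<in> S) \<and>
             emeasure lborel (S :: real set) \<le> segment_integral \<rho> x y))" for j
      proof (rule level[OF D f Qm M_def \<delta>pos _ W_borel])
        have d1: "5 * \<delta> j \<le> 1" using \<delta>60[of j] by auto
        show "bounded (T j)"
        proof (rule bounded_subset[OF bounded_cball])
          show "T j \<subseteq> cball a (R + 1)"
          proof
            fix p assume "p \<in> T j"
            then obtain y where "dist a y \<le> R" "dist y p < \<delta> j" by (auto simp: T_def)
            then show "p \<in> cball a (R + 1)" using dist_triangle[of a p y] d1 \<delta>pos[of j] by simp
          qed
        qed
        have "emeasure M (W j) \<le> emeasure M X"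
          by (intro emeasure_mono setsM X_borel) (auto simp: W_def split: nat.split)
        with X show "emeasure M (W j) < \<infinity>" by order
        show "cball p (4 * \<delta> j) \<subseteq> W j" if "p \<in> T j" for p
        proof
          fix z assume z: "z \<in> cball p (4 * \<delta> j)"
          obtain y where y: "dist a y \<le> R" "dist y p < \<delta> j" "\<And>i q. i < j \<Longrightarrow> q \<in> F i \<Longrightarrow> \<delta> i \<le> dist y q"
            using \<open>p \<in> T j\<close> by (auto simp: T_def)
          have yz: "dist y z \<le> 5 * \<delta> j" using dist_triangle[of y z p] y z by simp
          then have "z \<in> X" using dist_triangle[of a z y] y d1 by (simp add: X_def)
          \<comment> \<open>The point \<open>z\<close> is within
            \<open>5 * \<delta> j \<le> 5 * (\<delta> i / 6)\<close> of \<open>y\<close>, and a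
            point of \<open>F i\<close> within \<open>\<delta> i / 6\<close> of \<open>z\<close>
            would violate the margin \<open>\<delta> i\<close>. This is the origin of the factor
            6.\<close>
          moreover have "z \<notin> closure (F i)" if i: "j = Suc i" for i
          proof
            assume "z \<in> closure (F i)"
            then obtain q where q: "q \<in> F i" "dist q z < \<delta> i / 6"
              using \<delta>pos[of i] by (metis closure_approachable divide_pos_pos zero_less_numeral)
            have "\<delta> i \<le> dist y z + dist q z" using y(3)[of i q] q i dist_triangle2[of y q z] by simp
            also have "\<dots> < 5 * (\<delta> i / 6) + \<delta> i / 6" using yz q \<delta>_Suc[of i] i by simp
            finally show False by simp
          qed
          ultimately show "z \<in> W j" by (auto simp: W_def split: nat.split)
        qed
        show "modulus (lifted_paths D f p (2 * \<delta> j) (4 * \<delta> j)) \<le>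
           ennreal (1 / (2 * \<delta> j)) ^ DIM('a) * (\<integral>\<^sup>+ y \<in> cball p (4 * \<delta> j). Q y \<partial>lebesgue)" if "p \<in> T j" for p
        proof -
          have "4 * \<delta> j < r0 p" using that \<delta>_r0[of j] by (auto simp: T_def F_def A_def)
          with ring[of "2 * \<delta> j" "4 * \<delta> j" p] \<delta>pos[of j] show ?thesis by simp
        qed
      qed
      then obtain \<rho> where \<rho> [measurable]: "\<And>j. \<rho> j \<in> borel_measurable borel"
        and \<rho>_le: "\<And>j. (\<integral>\<^sup>+ x. \<rho> j x ^ DIM('a) \<partial>lborel) \<le> of_nat N * emeasure M (W j)"
        and \<rho>_adm: "\<And>j. \<forall>x y u. closed_segment x y \<subseteq> D \<longrightarrow> (\<forall>v w. \<bar>u v - u w\<bar> \<le> dist v w) \<longrightarrow> 8 * \<delta> j < \<bar>u (f x) - u (f y)\<bar> \<longrightarrow>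
          (\<exists>S\<in>sets lborel. (\<forall>s\<in>closed_segment x y. (\<exists>p\<in>T j. dist (f s) p < \<delta> j) \<longrightarrow> u (f s) \<in> S) \<and>
             emeasure lborel (S :: real set) \<le> segment_integral (\<rho> j) x y)"
        unfolding Bex_def by metis
      define \<sigma> where "\<sigma> x = (\<Sum>j. \<rho> j x)" for x
      have [measurable]: "\<sigma> \<in> borel_measurable borel" unfolding \<sigma>_def by measurable
      show "\<exists>\<rho>\<in>borel_measurable borel. (\<integral>\<^sup>+ x. \<rho> x ^ DIM('a) \<partial>lborel) \<le> ennreal (2 * c) \<and>
        (\<forall>x y u. closed_segment x y \<subseteq> D \<longrightarrow> (\<forall>v w. \<bar>u v - u w\<bar> \<le> dist v w) \<longrightarrow>
          (\<forall>z. min (u (f x)) (u (f y)) < u z \<longrightarrow> u z < max (u (f x)) (u (f y)) \<longrightarrow> z \<in> cball a R) \<longrightarrow>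
          \<epsilon> \<le> \<bar>u (f x) - u (f y)\<bar> \<longrightarrow> ennreal \<bar>u (f x) - u (f y)\<bar> \<le> segment_integral \<rho> x y)"
      proof (intro bexI[of _ \<sigma>] conjI allI impI)
        have "(\<integral>\<^sup>+ x. \<sigma> x ^ DIM('a) \<partial>lborel) \<le> (\<integral>\<^sup>+ x. (\<Sum>j. (2 ^ (j + 2)) ^ n * \<rho> j x ^ n) \<partial>lborel)"
          unfolding \<sigma>_def n_def[symmetric] power_mult_distrib[symmetric]
          by (intro nn_integral_mono suminf_power_le n)
        also have "\<dots> = (\<Sum>j. (2 ^ (j + 2)) ^ n * (\<integral>\<^sup>+ x. \<rho> j x ^ n \<partial>lborel))"
          by (simp add: nn_integral_suminf nn_integral_cmult)
        also have "\<dots> \<le> ennreal (2 * c)"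
        proof (rule ennreal_suminf_le_double[OF \<open>c \<ge> 0\<close>])
          fix j
          have "(2 ^ (j + 2)) ^ n * (\<integral>\<^sup>+ x. \<rho> j x ^ n \<partial>lborel) \<le> (2 ^ (j + 2)) ^ n * (of_nat N * emeasure M (W j))"
            using \<rho>_le[of j] by (intro mult_left_mono) (auto simp: n_def)
          also note W_le
          finally show "(2 ^ (j + 2)) ^ n * (\<integral>\<^sup>+ x. \<rho> j x ^ n \<partial>lborel) \<le> ennreal (c * (1 / 2) ^ j)" .
        qed
        finally show "(\<integral>\<^sup>+ x. \<sigma> x ^ DIM('a) \<partial>lborel) \<le> ennreal (2 * c)" .
      next
        fix x y and u :: "'a \<Rightarrow> real"
        assume seg: "closed_segment x y \<subseteq> D" and lip: "\<forall>v w. \<bar>u v - u w\<bar> \<le> dist v w"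
          and lev: "\<forall>z. min (u (f x)) (u (f y)) < u z \<longrightarrow> u z < max (u (f x)) (u (f y)) \<longrightarrow> z \<in> cball a R"
          and big: "\<epsilon> \<le> \<bar>u (f x) - u (f y)\<bar>"
        have "8 * \<delta> j < \<bar>u (f x) - u (f y)\<bar>" for j using \<delta>60[of j] big \<open>\<epsilon> > 0\<close> by auto
        then have "\<exists>S\<in>sets lborel. (\<forall>s\<in>closed_segment x y. (\<exists>p\<in>T j. dist (f s) p < \<delta> j) \<longrightarrow> u (f s) \<in> S) \<and>
             emeasure lborel (S :: real set) \<le> segment_integral (\<rho> j) x y" for j
          using \<rho>_adm[of j] seg lip by blast
        then obtain S where S: "\<And>j. S j \<in> sets lborel"
            "\<And>j s p. s \<in> closed_segment x y \<Longrightarrow> p \<in> T j \<Longrightarrow> dist (f s) p < \<delta> j \<Longrightarrow> u (f s) \<in> S j"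
            "\<And>j. emeasure lborel (S j) \<le> segment_integral (\<rho> j) x y"
          by metis
        define l r where "l = min (u (f x)) (u (f y))" and "r = max (u (f x)) (u (f y))"
        have "isCont u z" for z
          unfolding continuous_at_eps_delta dist_real_def using lip by (meson le_less_trans)
        then have "continuous_on UNIV u" by (simp add: continuous_on_eq_continuous_at)
        then have "continuous_on (closed_segment x y) (\<lambda>s. u (f s))"
          by (rule continuous_on_compose2[OF _ continuous_on_subset[OF f seg]]) auto
        then have conn: "connected ((\<lambda>s. u (f s)) ` closed_segment x y)"
          by (rule connected_continuous_image) simp
        \<comment> \<open>Each intermediate value is attained on the segment. The first level
          \<open>j\<close> at which the image point comes within \<open>\<delta> j\<close> of
          \<open>F j\<close> provides a centre in \<open>T j\<close>, since all earlier levels miss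
          that point.\<close>
        have "{l<..<r} \<subseteq> (\<Union>j. S j)"
        proof
          fix h assume h: "h \<in> {l<..<r}"
          have "l \<in> (\<lambda>s. u (f s)) ` closed_segment x y" "r \<in> (\<lambda>s. u (f s)) ` closed_segment x y"
            unfolding l_def r_def min_def max_def by auto
          then have "h \<in> (\<lambda>s. u (f s)) ` closed_segment x y"
            using connectedD_interval[OF conn, of l r h] h by auto
          then obtain s where s: "s \<in> closed_segment x y" "u (f s) = h" by auto
          then have fs: "f s \<in> cball a R" using lev h by (auto simp: l_def r_def)
          let ?in = "\<lambda>j. \<exists>q\<in>F j. dist (f s) q < \<delta> j"
          have "\<exists>j. ?in j" using F_ex[of "f s"] \<delta>pos by (metis dist_self)
          then obtain j where j: "?in j" "\<And>i. i < j \<Longrightarrow> \<not> ?in i"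
            using exists_least_iff[of ?in] by blast
          then obtain q where q: "q \<in> F j" "dist (f s) q < \<delta> j" by blast
          have "q \<in> T j" using q fs j(2) by (auto simp: T_def not_less)
          with S(2)[OF s(1) _ q(2)] s show "h \<in> (\<Union>j. S j)" by blast
        qed
        have "\<bar>u (f x) - u (f y)\<bar> = r - l" by (auto simp: l_def r_def)
        moreover have "l \<le> r" by (simp add: l_def r_def)
        ultimately have "ennreal \<bar>u (f x) - u (f y)\<bar> = emeasure lborel {l<..<r}" by simp
        also have "\<dots> \<le> emeasure lborel (\<Union>j. S j)"
          using S(1) \<open>{l<..<r} \<subseteq> (\<Union>j. S j)\<close> by (intro emeasure_mono) auto
        also have "\<dots> \<le> (\<Sum>j. emeasure lborel (S j))"
          using S(1) by (intro emeasure_subadditive_countably) auto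
        also have "\<dots> \<le> (\<Sum>j. segment_integral (\<rho> j) x y)"
          using S(3) by (intro suminf_le) auto
        also have "\<dots> = segment_integral \<sigma> x y"
          unfolding \<sigma>_def by (intro segment_integral_suminf[symmetric]) measurable
        finally show "ennreal \<bar>u (f x) - u (f y)\<bar> \<le> segment_integral \<sigma> x y" .
      qed measurable
    qed
  qed
qed

section \<open>Equicontinuity\<close>

text \<open>Comparing distances to \<open>a\<close> shows that \<open>p\<close> and the point on the
  ray are at least \<open>(1 - s) * dist y1 a + t * dist y2 a\<close> apart, where \<open>s\<close>
  is the position of \<open>p\<close> on the segment. That is the sum of the distances of these
  points from \<open>y1\<close> and \<open>y2\<close>, so the triangle inequality finishes.\<close>

lemma dist_segment_ray:
  fixes a :: "'a::real_normed_vector"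
  assumes "dist y1 a \<le> dist y2 a" and p: "p \<in> closed_segment a y1" and "t \<ge> 0"
  shows "dist y1 y2 \<le> 2 * dist p (y2 + t *\<^sub>R (y2 - a))"
proof -
  obtain s where s: "0 \<le> s" "s \<le> 1" "p = a + s *\<^sub>R (y1 - a)"
    using p by (auto simp: closed_segment_def algebra_simps)
  define q where "q = y2 + t *\<^sub>R (y2 - a)"
  have "q - a = (1 + t) *\<^sub>R (y2 - a)" by (simp add: q_def algebra_simps)
  then have qa: "dist q a = (1 + t) * dist y2 a" using \<open>t \<ge> 0\<close> by (simp add: dist_norm)
  have pa: "dist p a = s * dist y1 a" using s by (simp add: dist_norm)
  have "y1 - p = (1 - s) *\<^sub>R (y1 - a)" using s by (simp add: algebra_simps)
  then have yp: "dist y1 p = (1 - s) * dist y1 a" using s by (simp add: dist_norm)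
  have qy: "dist q y2 = t * dist y2 a" using \<open>t \<ge> 0\<close> by (simp add: q_def dist_norm)
  have "dist q a \<le> dist p q + dist p a" by (metis dist_commute dist_triangle)
  then have "t * dist y2 a + (1 - s) * dist y1 a \<le> dist p q"
    using assms(1) unfolding qa pa by (simp add: algebra_simps)
  moreover have "dist y1 y2 \<le> dist y1 p + dist p q + dist q y2"
    by (meson add_mono dist_triangle order_refl order_trans)
  ultimately show ?thesis unfolding yp qy q_def[symmetric] by linarith
qed

lemma closed_ray: "closed ((\<lambda>t. y + t *\<^sub>R v) ` {0..})" for v :: "'a::euclidean_space"
proof (cases "v = 0")
  case True
  then show ?thesis by (simp add: image_constant_conv)
next
  case False
  have "closed ((\<lambda>t. t *\<^sub>R v) ` {0..})"
    using False by (intro closed_injective_linear_image) (auto simp: inj_on_def intro: linearI scaleR_add_left)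
  then have "closed ((+) y ` (\<lambda>t. t *\<^sub>R v) ` {0..})" by (rule closed_translation)
  then show ?thesis by (simp add: image_image)
qed

lemma unbounded_ray:
  fixes v :: "'a::real_normed_vector"
  assumes "v \<noteq> 0"
  shows "\<not> bounded ((\<lambda>t. y + t *\<^sub>R v) ` {0..})"
proof
  assume "bounded ((\<lambda>t. y + t *\<^sub>R v) ` {0..})"
  then obtain K where K: "\<And>t. t \<ge> 0 \<Longrightarrow> norm (y + t *\<^sub>R v) \<le> K" by (auto simp: bounded_iff)
  define t where "t = (\<bar>K\<bar> + norm y + 1) / norm v"
  have "t \<ge> 0" using assms by (simp add: t_def)
  have "norm (t *\<^sub>R v) = \<bar>K\<bar> + norm y + 1" using assms \<open>t \<ge> 0\<close> by (simp add: t_def)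
  moreover have "norm (t *\<^sub>R v) \<le> norm (y + t *\<^sub>R v) + norm y"
    using norm_triangle_ineq4[of "y + t *\<^sub>R v" y] by simp
  ultimately show False using K[OF \<open>t \<ge> 0\<close>] by linarith
qed

text \<open>Both denominators are at least 1, which gives the Euclidean bound. With
  \<open>norm (p - q) \<le> A + B\<close> the chordal distance is at most
  \<open>1 / A + 1 / B\<close>, hence below \<open>\<epsilon>\<close> if both points are far
  out.\<close>

lemma chordal_dist_ge_imp:
  fixes p q :: "'a::real_normed_vector"
  assumes "\<epsilon> > 0" "\<epsilon> \<le> chordal_dist (Some p) (Some q)"
  shows "\<epsilon> \<le> dist p q" "norm p \<le> 2 / \<epsilon> \<or> norm q \<le> 2 / \<epsilon>"
proof -
  define A B where "A = sqrt (1 + (norm p)\<^sup>2)" and "B = sqrt (1 + (norm q)\<^sup>2)"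
  have A: "A \<ge> 1" "A \<ge> norm p" and B: "B \<ge> 1" "B \<ge> norm q"
    by (auto simp: A_def B_def intro!: real_le_rsqrt)
  have le: "\<epsilon> \<le> norm (p - q) / (A * B)" using assms by (simp add: A_def B_def)
  have AB: "A * B \<ge> 1" using mult_mono[of 1 A 1 B] A B by simp
  then have "norm (p - q) / (A * B) \<le> norm (p - q) / 1" by (intro divide_left_mono) auto
  with le show "\<epsilon> \<le> dist p q" by (simp add: dist_norm)
  show "norm p \<le> 2 / \<epsilon> \<or> norm q \<le> 2 / \<epsilon>"
  proof (rule ccontr)
    assume "\<not> ?thesis"
    then have "A > 2 / \<epsilon>" "B > 2 / \<epsilon>" using A B by auto
    then have AB': "1 / A < \<epsilon> / 2" "1 / B < \<epsilon> / 2" using assms(1) A B by (auto simp: field_simps)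
    have "norm (p - q) \<le> A + B" using norm_triangle_ineq4[of p q] A B by linarith
    then have "norm (p - q) / (A * B) \<le> (A + B) / (A * B)" using AB by (intro divide_right_mono) auto
    also have "\<dots> = 1 / A + 1 / B" using A B by (simp add: field_simps)
    finally show False using AB' le by linarith
  qed
qed

text \<open>Here the two energy estimates collide: many rings force a large energy through
  \<open>loewner_log\<close>, while \<open>energy_bound\<close> caps it uniformly in
  \<open>f\<close>. The bound \<open>B\<close> on the value nearer to \<open>a\<close> keeps the
  region where \<open>Q\<close> matters fixed.\<close>

lemma poletsky_family_separation:
  fixes D :: "'a::euclidean_space set" and \<epsilon> :: real
  assumes dim: "DIM('a) \<ge> 2" and D: "open D" and Q: "locally_integrable Q"
    and "d > 0" and sub: "cball x0 d \<subseteq> D" and "\<epsilon> > 0"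
  obtains \<delta> where "\<delta> > 0" "\<And>f x1 x2. f \<in> poletsky_family Q a D \<Longrightarrow> dist x1 x0 < \<delta> \<Longrightarrow> dist x2 x0 < \<delta> \<Longrightarrow>
     dist (f x1) a \<le> dist (f x2) a \<Longrightarrow> dist (f x1) a \<le> B \<Longrightarrow> dist (f x1) (f x2) < \<epsilon>"
proof -
  \<comment> \<open>The function \<open>u\<close> below is 0 on the image of one continuum and
    \<open>\<epsilon> / 2\<close> on that of the other, so its value at any third point differs from
    one of these by at least \<open>\<epsilon> / 4\<close>.\<close>
  have e4: "\<epsilon> / 4 > 0" using \<open>\<epsilon> > 0\<close> by simp
  show thesis
  proof (rule loewner_log[OF dim e4], rule energy_bound[OF D Q, of a "B + \<epsilon>"])
    fix \<kappa> C :: real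
    assume "\<kappa> > 0" and loewner: "\<And>(\<rho> :: 'a \<Rightarrow> ennreal) E F x0 \<delta> J. \<rho> \<in> borel_measurable borel \<Longrightarrow> \<delta> > 0 \<Longrightarrow>
       (\<And>\<tau>. \<delta> \<le> \<tau> \<Longrightarrow> \<tau> \<le> 16 ^ J * \<delta> \<Longrightarrow> \<exists>x\<in>E. dist x x0 = \<tau>) \<Longrightarrow>
       (\<And>\<tau>. \<delta> \<le> \<tau> \<Longrightarrow> \<tau> \<le> 16 ^ J * \<delta> \<Longrightarrow> \<exists>x\<in>F. dist x x0 = \<tau>) \<Longrightarrow>
       (\<And>x y z. x \<in> E \<Longrightarrow> y \<in> F \<Longrightarrow> x \<in> ball x0 (16 ^ J * \<delta>) \<Longrightarrow> y \<in> ball x0 (16 ^ J * \<delta>) \<Longrightarrow>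
          z \<in> ball x0 (16 ^ J * \<delta>) \<Longrightarrow> ennreal (\<epsilon> / 4) \<le> segment_integral \<rho> x z + segment_integral \<rho> y z) \<Longrightarrow>
       ennreal (real J * \<kappa>) \<le> (\<integral>\<^sup>+ x. \<rho> x ^ DIM('a) \<partial>lborel)"
      and energy: "\<And>f e. continuous_on D f \<Longrightarrow> (\<And>y. inverse_Poletsky D Q f y) \<Longrightarrow> e > 0 \<Longrightarrow>
        \<exists>\<rho>\<in>borel_measurable borel. (\<integral>\<^sup>+ x. \<rho> x ^ DIM('a) \<partial>lborel) \<le> ennreal C \<and>
          (\<forall>x y u. closed_segment x y \<subseteq> D \<longrightarrow> (\<forall>v w. \<bar>u v - u w\<bar> \<le> dist v w) \<longrightarrow>
            (\<forall>z. min (u (f x)) (u (f y)) < u z \<longrightarrow> u z < max (u (f x)) (u (f y)) \<longrightarrow> z \<in> cball a (B + \<epsilon>)) \<longrightarrow>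
            e \<le> \<bar>u (f x) - u (f y)\<bar> \<longrightarrow> ennreal \<bar>u (f x) - u (f y)\<bar> \<le> segment_integral \<rho> x y)"
    \<comment> \<open>With \<open>J\<close> rings the lower bound exceeds \<open>C\<close>; dividing
      \<open>d\<close> by \<open>16 ^ J\<close> places the radii \<open>16 ^ j * \<delta>\<close>
      between \<open>\<delta>\<close> and \<open>d\<close>.\<close>
    obtain J :: nat where J: "\<bar>C\<bar> / \<kappa> < real J" using reals_Archimedean2 by blast
    define \<delta> where "\<delta> = d / 16 ^ J"
    have "\<delta> > 0" and d: "16 ^ J * \<delta> = d" using \<open>d > 0\<close> by (simp_all add: \<delta>_def)
    show thesis
    proof (rule that[OF \<open>\<delta> > 0\<close>], rule ccontr)
      fix f x1 x2
      assume fam: "f \<in> poletsky_family Q a D" and x1: "dist x1 x0 < \<delta>" and x2: "dist x2 x0 < \<delta>"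
        and le: "dist (f x1) a \<le> dist (f x2) a" and B: "dist (f x1) a \<le> B" and "\<not> dist (f x1) (f x2) < \<epsilon>"
      then have far: "\<epsilon> \<le> dist (f x1) (f x2)" by simp
      have f: "continuous_on D f" and omit: "a \<notin> f ` D" and P: "\<And>y. inverse_Poletsky D Q f y"
        using fam by (auto simp: poletsky_family_def)
      have opn: "open (f ` U)" if "open U" "U \<subseteq> D" for U
        using fam that D by (auto simp: poletsky_family_def open_map_def openin_open_eq)
      have "1 * \<delta> \<le> 16 ^ J * \<delta>" using \<open>\<delta> > 0\<close> by (intro mult_right_mono) auto
      then have "\<delta> \<le> d" using d by simp
      then have ball: "x1 \<in> ball x0 d" "x2 \<in> ball x0 d" using x1 x2 by (auto simp: dist_commute)
      then have "x1 \<in> D" "x2 \<in> D" using sub by auto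
      define T1 where "T1 = closed_segment a (f x1)"
      define T2 where "T2 = (\<lambda>t. f x2 + t *\<^sub>R (f x2 - a)) ` {0..}"
      have T1: "closed T1" "connected T1" "f x1 \<in> T1" "T1 \<noteq> {}" by (auto simp: T1_def)
      \<comment> \<open>The segment contains the omitted value \<open>a\<close>; the ray
        \<open>T2\<close> is unbounded while the image of the closed ball is compact. So neither set
        is covered by that image, as \<open>continuum_lift\<close> requires.\<close>
      have "\<not> T1 \<subseteq> f ` cball x0 d"
        using omit sub ends_in_segment(1)[of a "f x1"] unfolding T1_def by blast
      from continuum_lift[OF f opn sub ball(1) T1(1-3) this]
      obtain E where E: "connected E" "x1 \<in> E" "E \<subseteq> cball x0 d" "f ` E \<subseteq> T1" "E \<inter> sphere x0 d \<noteq> {}" by blast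
      have "f x2 \<noteq> a" using omit \<open>x2 \<in> D\<close> by blast
      have "compact (f ` cball x0 d)"
        using f sub by (intro compact_continuous_image continuous_on_subset[OF f]) auto
      then have T2_not: "\<not> T2 \<subseteq> f ` cball x0 d"
        using unbounded_ray[of "f x2 - a" "f x2"] \<open>f x2 \<noteq> a\<close> unfolding T2_def
        by (meson bounded_subset compact_imp_bounded right_minus_eq)
      have T2: "closed T2" unfolding T2_def by (rule closed_ray)
      have T2': "connected T2" unfolding T2_def
        by (intro connected_continuous_image continuous_intros) auto
      have "f x2 \<in> T2" unfolding T2_def by (intro image_eqI[of _ _ 0]) auto
      from continuum_lift[OF f opn sub ball(2) T2 T2' this T2_not]
      obtain F where F: "connected F" "x2 \<in> F" "F \<subseteq> cball x0 d" "f ` F \<subseteq> T2" "F \<inter> sphere x0 d \<noteq> {}" by blast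
      \<comment> \<open>Truncating the distance from \<open>T1\<close> at
        \<open>\<epsilon> / 2\<close> makes \<open>u\<close> constant far away, in particular along
        the unbounded ray, so values strictly between 0 and \<open>\<epsilon> / 2\<close> occur only
        near the bounded segment \<open>T1\<close>.\<close>
      define u where "u z = min (infdist z T1) (\<epsilon> / 2)" for z
      have lip: "\<bar>u v - u w\<bar> \<le> dist v w" for v w
        using infdist_triangle_abs[of v T1 w] unfolding u_def by linarith
      have u_range: "0 \<le> u z" "u z \<le> \<epsilon> / 2" for z using \<open>\<epsilon> > 0\<close> by (auto simp: u_def infdist_nonneg)
      have u0: "u (f x) = 0" if "x \<in> E" for x
        using that E(4) \<open>\<epsilon> > 0\<close> by (auto simp: u_def)
      have u1: "u (f y) = \<epsilon> / 2" if "y \<in> F" for y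
      proof -
        have "f y \<in> T2" using that F(4) by blast
        then obtain t where t: "t \<ge> 0" "f y = f x2 + t *\<^sub>R (f x2 - a)" by (auto simp: T2_def)
        obtain p where p: "p \<in> T1" "infdist (f y) T1 = dist (f y) p"
          using infdist_attains_inf[OF T1(1) T1(4)] by metis
        have "dist (f x1) (f x2) \<le> 2 * dist p (f y)"
          using dist_segment_ray[OF le _ t(1), of p] p(1) t(2) by (simp add: T1_def)
        then show ?thesis using far p by (simp add: u_def dist_commute)
      qed
      have level: "z \<in> cball a (B + \<epsilon>)" if "0 < u z" "u z < \<epsilon> / 2" for z
      proof -
        obtain p where p: "p \<in> T1" "infdist z T1 = dist z p"
          using infdist_attains_inf[OF T1(1) T1(4)] by metis
        have "dist z p < \<epsilon> / 2" using that p by (simp add: u_def split: if_splits add: min_def)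
        moreover have "dist a p \<le> dist a (f x1)" using p(1) segment_bound1[of p a "f x1"]
          by (simp add: T1_def dist_norm norm_minus_commute)
        ultimately show ?thesis using dist_triangle[of a z p] B \<open>\<epsilon> > 0\<close> by (simp add: dist_commute)
      qed
      obtain \<rho> where \<rho>: "\<rho> \<in> borel_measurable borel" "(\<integral>\<^sup>+ x. \<rho> x ^ DIM('a) \<partial>lborel) \<le> ennreal C"
        and adm: "\<forall>x y u. closed_segment x y \<subseteq> D \<longrightarrow> (\<forall>v w. \<bar>u v - u w\<bar> \<le> dist v w) \<longrightarrow>
            (\<forall>z. min (u (f x)) (u (f y)) < u z \<longrightarrow> u z < max (u (f x)) (u (f y)) \<longrightarrow> z \<in> cball a (B + \<epsilon>)) \<longrightarrow>
            \<epsilon> / 4 \<le> \<bar>u (f x) - u (f y)\<bar> \<longrightarrow> ennreal \<bar>u (f x) - u (f y)\<bar> \<le> segment_integral \<rho> x y"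
        using energy[OF f P \<open>\<epsilon> / 4 > 0\<close>] by blast
      have long: "ennreal (\<epsilon> / 4) \<le> segment_integral \<rho> x y"
        if "x \<in> ball x0 d" "y \<in> ball x0 d" and big: "\<epsilon> / 4 \<le> \<bar>u (f x) - u (f y)\<bar>" for x y
      proof -
        have "closed_segment x y \<subseteq> ball x0 d" using that by (simp add: closed_segment_subset)
        then have "closed_segment x y \<subseteq> D" using sub by (meson ball_subset_cball order_trans)
        moreover have "\<forall>z. min (u (f x)) (u (f y)) < u z \<longrightarrow> u z < max (u (f x)) (u (f y)) \<longrightarrow> z \<in> cball a (B + \<epsilon>)"
        proof (intro allI impI level)
          fix z assume "min (u (f x)) (u (f y)) < u z" "u z < max (u (f x)) (u (f y))"
          then show "0 < u z" "u z < \<epsilon> / 2" using u_range[of "f x"] u_range[of "f y"] by auto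
        qed
        ultimately have "ennreal \<bar>u (f x) - u (f y)\<bar> \<le> segment_integral \<rho> x y" using adm lip big by blast
        then show ?thesis using ennreal_leI[OF big] by order
      qed
      have radii: "\<exists>x\<in>G. dist x x0 = \<tau>"
        if G: "connected G" "x \<in> G" "dist x x0 < \<delta>" "G \<inter> sphere x0 d \<noteq> {}" and \<tau>: "\<delta> \<le> \<tau>" "\<tau> \<le> 16 ^ J * \<delta>" for G x \<tau>
      proof -
        obtain y where "y \<in> G" "y \<in> sphere x0 d" using G(4) by blast
        then have "y \<in> G" "dist x x0 \<le> \<tau>" "\<tau> \<le> dist y x0"
          using G(3) \<tau> d by (auto simp: dist_commute)
        from connected_meets_sphere[OF G(1,2) this] show ?thesis by blast
      qed
      have "ennreal (real J * \<kappa>) \<le> (\<integral>\<^sup>+ x. \<rho> x ^ DIM('a) \<partial>lborel)"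
      proof (rule loewner[OF \<rho>(1) \<open>\<delta> > 0\<close>])
        show "\<exists>x\<in>E. dist x x0 = \<tau>" if "\<delta> \<le> \<tau>" "\<tau> \<le> 16 ^ J * \<delta>" for \<tau>
          by (rule radii[OF E(1,2) x1 E(5) that])
        show "\<exists>x\<in>F. dist x x0 = \<tau>" if "\<delta> \<le> \<tau>" "\<tau> \<le> 16 ^ J * \<delta>" for \<tau>
          by (rule radii[OF F(1,2) x2 F(5) that])
        show "ennreal (\<epsilon> / 4) \<le> segment_integral \<rho> x z + segment_integral \<rho> y z"
          if "x \<in> E" "y \<in> F" "x \<in> ball x0 (16 ^ J * \<delta>)" "y \<in> ball x0 (16 ^ J * \<delta>)" "z \<in> ball x0 (16 ^ J * \<delta>)" for x y z
        proof -
          have "\<epsilon> / 4 \<le> \<bar>u (f x) - u (f z)\<bar> \<or> \<epsilon> / 4 \<le> \<bar>u (f y) - u (f z)\<bar>"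
            using u0[OF that(1)] u1[OF that(2)] by linarith
          then show ?thesis
            using long[of x z] long[of y z] that(3-5) unfolding d
            by (auto intro: add_increasing add_increasing2)
        qed
      qed
      also note \<rho>(2)
      finally have "ennreal (real J * \<kappa>) \<le> ennreal C" .
      moreover have "\<bar>C\<bar> < real J * \<kappa>" using J \<open>\<kappa> > 0\<close> by (simp add: field_simps)
      ultimately show False by (auto simp: ennreal_le_iff2)
    qed
  qed
qed

theorem corollary1p1:
  fixes D :: "'a::euclidean_space set"
    and Q :: "'a \<Rightarrow> ennreal"
    and a :: 'a
  assumes "DIM('a) \<ge> 2"
    and "open D" and "connected D" and "D \<noteq> {}"
    and "Q \<in> borel_measurable lebesgue"
    and "locally_integrable Q"
  shows "\<forall>x0\<in>D. chordal_equicontinuous_at D ((\<lambda>f x. Some (f x)) ` poletsky_family Q a D) x0"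
proof
  fix x0 assume "x0 \<in> D"
  then obtain d where d: "d > 0" "cball x0 d \<subseteq> D"
    using \<open>open D\<close> open_contains_cball by blast
  show "chordal_equicontinuous_at D ((\<lambda>f x. Some (f x)) ` poletsky_family Q a D) x0"
    unfolding chordal_equicontinuous_at_def
  proof (intro allI impI)
    fix \<epsilon> :: real assume "\<epsilon> > 0"
    \<comment> \<open>Values that are chordally \<open>\<epsilon>\<close> apart cannot both have
      norm above \<open>2 / \<epsilon>\<close>, so one of them lies within \<open>B\<close> of
      \<open>a\<close>.\<close>
    define B where "B = 2 / \<epsilon> + norm a"
    obtain \<delta> where "\<delta> > 0" and \<delta>: "\<And>f x1 x2. f \<in> poletsky_family Q a D \<Longrightarrow> dist x1 x0 < \<delta> \<Longrightarrow> dist x2 x0 < \<delta> \<Longrightarrow>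
        dist (f x1) a \<le> dist (f x2) a \<Longrightarrow> dist (f x1) a \<le> B \<Longrightarrow> dist (f x1) (f x2) < \<epsilon>"
      using poletsky_family_separation[OF assms(1,2,6) d \<open>\<epsilon> > 0\<close>, of a B] by metis
    have "chordal_dist (Some (f x)) (Some (f x0)) < \<epsilon>"
      if f: "f \<in> poletsky_family Q a D" and x: "dist x x0 < \<delta>" for f x
    proof (rule ccontr)
      assume "\<not> ?thesis"
      then have "\<epsilon> \<le> chordal_dist (Some (f x)) (Some (f x0))" by simp
      note far = chordal_dist_ge_imp[OF \<open>\<epsilon> > 0\<close> this]
      have "dist y a \<le> norm y + norm a" for y by (simp add: dist_norm norm_triangle_ineq4)
      then have B: "dist (f x) a \<le> B \<or> dist (f x0) a \<le> B"
        using far(2) unfolding B_def by (smt (verit))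
      show False
      \<comment> \<open>The point whose value is nearer to \<open>a\<close> plays the role of
        \<open>x1\<close>; the bound \<open>B\<close> holds for the nearer value as soon as it holds
        for either.\<close>
      proof (cases "dist (f x) a \<le> dist (f x0) a")
        case True
        then show False using \<delta>[OF f x _ True] \<open>\<delta> > 0\<close> B far(1) by auto
      next
        case False
        then show False using \<delta>[OF f _ x, of x0] \<open>\<delta> > 0\<close> B far(1) by (auto simp: dist_commute)
      qed
    qed
    then show "\<exists>\<delta>>0. \<forall>f\<in>(\<lambda>f x. Some (f x)) ` poletsky_family Q a D. \<forall>x\<in>D.
        dist x x0 < \<delta> \<longrightarrow> chordal_dist (f x) (f x0) < \<epsilon>"
      using \<open>\<delta> > 0\<close> by (intro exI[of _ \<delta>]) auto
  qed
qed

end
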